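(* Let $k$ be a positive integer. Suppose $C\subseteq\mathbb{R}^n$ is a proper convex cone such that for any $N\in\mathbb{N}$ there is a subset $V_N\subseteq\mathrm{ext}(C)$ such that $|V_N|\geq N$ and $C$ is $k$-neighborly with respect to $V_N$. If $p$ is a homogeneous polynomial with real coefficients that is hyperbolic with respect to $e$ and all the irreducible factors of $p$ have degree at most $k$, then $C$ does not have a $\Lambda_+(p,e)$-lift.
   Context: Fix an inner product $\langle\cdot,\cdot\rangle$ on $\mathbb{R}^n$ with associated norm $\|\cdot\|$. For $C\subseteq\mathbb{R}^n$, the dual cone is $C^*=\{f\in\mathbb{R}^n : \langle f,x\rangle\geq 0 \text{ for all } x\in C\}$. A convex cone $C\subseteq\mathbb{R}^n$ is proper if it is closed, pointed ($C\cap(-C)=\{0\}$) and full-dimensional ($\mathrm{span}(C)=\mathbb{R}^n$). Lift: if $C\subseteq\mathbb{R}^n$ and $K\subseteq\mathbb{R}^d$ are closed convex cones, $C$ has a $K$-lift if $C=\pi(K\cap L)$ for some linear map $\pi:\mathbb{R}^d\to\mathbb{R}^n$ and some linear subspace $L\subseteq\mathbb{R}^d$. $\mathrm{ext}(C)$ is the set of normalized extreme rays of $C$, i.e. the unit vectors $v$ (with $\|v\|=1$) such that $\mathbb{R}_+v$ is an extreme ray of $C$. Neighborliness: if $C$ is a proper convex cone and $V\subseteq\mathrm{ext}(C)$, then $C$ is $k$-neighborly with respect to $V$ if for every $k$-element subset $W\subset V$ there is $f_W\in C^*$ such that $\langle f_W,v\rangle=0$ for $v\in W$ and $\langle f_W,v\rangle>0$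 for $v\in V\setminus W$. Hyperbolicity: a homogeneous polynomial $p$ in $q$ variables with real coefficients is hyperbolic with respect to $e\in\mathbb{R}^q$ if $p(e)>0$ and, for all $x\in\mathbb{R}^q$, the univariate polynomial $t\mapsto p(te-x)$ has only real roots; these roots are the hyperbolic eigenvalues of $x$. The hyperbolicity cone is $\Lambda_+(p,e)=\{x\in\mathbb{R}^q : \text{all hyperbolic eigenvalues of } x \text{ are nonnegative}\}$, which is a closed convex cone (a result of Gårding). Irreducible factors of $p$ are its factors in a factorization into irreducible real polynomials. *)

theory Defs
  imports
    "HOL-Analysis.Analysis"
    "HOL-Computational_Algebra.Computational_Algebra"
    "HOL-Library.Poly_Mapping"
begin

section \<open>Cones, lifts and neighborliness\<close>

text \<open>The inner product \<open>ip\<close> on \<open>real ^ 'n\<close> is arbitrary, not necessarily the standard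
  one of the library. The topology does not depend on this choice.\<close>

definition is_inner_product :: "(real ^ 'n \<Rightarrow> real ^ 'n \<Rightarrow> real) \<Rightarrow> bool" where
  "is_inner_product ip \<longleftrightarrow>
     bilinear ip \<and> (\<forall>x y. ip x y = ip y x) \<and> (\<forall>x. x \<noteq> 0 \<longrightarrow> ip x x > 0)"

definition ip_norm :: "(real ^ 'n \<Rightarrow> real ^ 'n \<Rightarrow> real) \<Rightarrow> real ^ 'n \<Rightarrow> real" where
  "ip_norm ip x = sqrt (ip x x)"

definition dual_cone :: "(real ^ 'n \<Rightarrow> real ^ 'n \<Rightarrow> real) \<Rightarrow> (real ^ 'n) set \<Rightarrow> (real ^ 'n) set" where
  "dual_cone ip C = {f. \<forall>x\<in>C. ip f x \<ge> 0}"

definition proper_cone :: "(real ^ 'n) set \<Rightarrow> bool" where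
  "proper_cone C \<longleftrightarrow> convex_cone C \<and> closed C \<and> C \<inter> uminus ` C = {0} \<and> span C = UNIV"

text \<open>A ray is extreme when it is a face.\<close>

definition ext_rays :: "(real ^ 'n \<Rightarrow> real ^ 'n \<Rightarrow> real) \<Rightarrow> (real ^ 'n) set \<Rightarrow> (real ^ 'n) set" where
  "ext_rays ip C = {v. ip_norm ip v = 1 \<and> {c *\<^sub>R v |c. c \<ge> 0} face_of C}"

definition neighborly ::
  "(real ^ 'n \<Rightarrow> real ^ 'n \<Rightarrow> real) \<Rightarrow> nat \<Rightarrow> (real ^ 'n) set \<Rightarrow> (real ^ 'n) set \<Rightarrow> bool" where
  "neighborly ip k C V \<longleftrightarrow>
     (\<forall>W. W \<subseteq> V \<and> finite W \<and> card W = k \<longrightarrow>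
        (\<exists>f\<in>dual_cone ip C. (\<forall>v\<in>W. ip f v = 0) \<and> (\<forall>v\<in>V - W. ip f v > 0)))"

definition has_lift :: "(real ^ 'n) set \<Rightarrow> (real ^ 'd) set \<Rightarrow> bool" where
  "has_lift C K \<longleftrightarrow>
     (\<exists>(\<pi> :: real ^ 'd \<Rightarrow> real ^ 'n) L. linear \<pi> \<and> subspace L \<and> C = \<pi> ` (K \<inter> L))"


section \<open>Polynomials in several variables\<close>

text \<open>A real polynomial in variables indexed by the finite type \<open>'q\<close> is a finitely
  supported map from exponent vectors to coefficients; \<^theory>\<open>HOL-Library.Poly_Mapping\<close>
  makes this type a commutative ring, multiplication being convolution. So \<open>irreducible\<close>
  and \<open>dvd\<close> for it are the library's ring-theoretic notions.\<close>

type_synonym 'q mpoly = "('q \<Rightarrow>\<^sub>0 nat) \<Rightarrow>\<^sub>0 real"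

text \<open>The value at \<open>v\<close> in a commutative semiring, coefficients being mapped there by \<open>h\<close>.\<close>

definition mpoly_subst ::
  "(real \<Rightarrow> 'a::comm_semiring_1) \<Rightarrow> 'q::finite mpoly \<Rightarrow> ('q \<Rightarrow> 'a) \<Rightarrow> 'a" where
  "mpoly_subst h p v =
     (\<Sum>m\<in>Poly_Mapping.keys p.
        h (Poly_Mapping.lookup p m) * (\<Prod>i\<in>UNIV. v i ^ Poly_Mapping.lookup m i))"

definition mpoly_eval :: "'q::finite mpoly \<Rightarrow> real ^ 'q \<Rightarrow> real" where
  "mpoly_eval p x = mpoly_subst (\<lambda>a. a) p (\<lambda>i. x $ i)"

definition monom_degree :: "('q::finite \<Rightarrow>\<^sub>0 nat) \<Rightarrow> nat" where
  "monom_degree m = (\<Sum>i\<in>UNIV. Poly_Mapping.lookup m i)"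

text \<open>The total degree; the zero polynomial has degree 0.\<close>

definition mpoly_degree :: "'q::finite mpoly \<Rightarrow> nat" where
  "mpoly_degree p = Max (insert 0 (monom_degree ` Poly_Mapping.keys p))"

definition homogeneous_mpoly :: "'q::finite mpoly \<Rightarrow> bool" where
  "homogeneous_mpoly p \<longleftrightarrow> (\<exists>d. \<forall>m\<in>Poly_Mapping.keys p. monom_degree m = d)"


section \<open>Hyperbolicity\<close>

text \<open>The univariate polynomial \<open>t \<mapsto> p (t e - x)\<close>.\<close>

definition line_poly :: "'q::finite mpoly \<Rightarrow> real ^ 'q \<Rightarrow> real ^ 'q \<Rightarrow> real poly" where
  "line_poly p e x = mpoly_subst (\<lambda>a. [:a:]) p (\<lambda>i. [:- (x $ i), e $ i:])"

lemma poly_line_poly: "poly (line_poly p e x) t = mpoly_eval p (t *\<^sub>R e - x)"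
  by (simp add: line_poly_def mpoly_eval_def mpoly_subst_def poly_sum poly_prod algebra_simps)

definition real_rooted :: "real poly \<Rightarrow> bool" where
  "real_rooted f \<longleftrightarrow> (\<forall>z :: complex. poly (map_poly complex_of_real f) z = 0 \<longrightarrow> z \<in> \<real>)"

definition hyperbolic :: "'q::finite mpoly \<Rightarrow> real ^ 'q \<Rightarrow> bool" where
  "hyperbolic p e \<longleftrightarrow>
     homogeneous_mpoly p \<and> mpoly_eval p e > 0 \<and> (\<forall>x. real_rooted (line_poly p e x))"

definition hyp_eigenvalues :: "'q::finite mpoly \<Rightarrow> real ^ 'q \<Rightarrow> real ^ 'q \<Rightarrow> real set" where
  "hyp_eigenvalues p e x = {t. poly (line_poly p e x) t = 0}"

definition hyp_cone :: "'q::finite mpoly \<Rightarrow> real ^ 'q \<Rightarrow> (real ^ 'q) set" where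
  "hyp_cone p e = {x. \<forall>t\<in>hyp_eigenvalues p e x. t \<ge> 0}"

end

theory Submission
  imports Defs "HOL-Library.Ramsey"
begin

text \<open>
  Suppose \<open>C = \<pi> (K \<inter> L)\<close> with \<open>K\<close> the hyperbolicity cone of \<open>p\<close>. The irreducible factors
  of \<open>p\<close> can be taken hyperbolic with respect to \<open>e\<close>, and \<open>K\<close> is the intersection of their
  hyperbolicity cones \<open>K\<^sub>f\<close> (\<open>hyp_cone_as_intersection\<close>). For every extreme ray \<open>v\<close> choose
  \<open>x\<^sub>v \<in> K \<inter> L\<close> above it, and put \<open>y\<^sub>W = \<Sum>\<^sub>w\<^sub>\<in>\<^sub>W x\<^sub>w\<close> for a finite set \<open>W\<close> of rays. Say that \<open>v\<close> depends on
  \<open>W\<close> in \<open>K\<^sub>f\<close> if \<open>y\<^sub>W - \<epsilon> x\<^sub>v \<in> K\<^sub>f\<close> for some \<open>\<epsilon> > 0\<close>, that is, if \<open>x\<^sub>v\<close> lies in the smallest face of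
  \<open>K\<^sub>f\<close> that contains \<open>y\<^sub>W\<close>.

  Let \<open>\<bar>W\<bar> = k\<close> and \<open>v \<notin> W\<close>. Neighborliness gives a functional that is nonnegative on \<open>C\<close>,
  zero on \<open>W\<close> and positive at \<open>v\<close>. It is negative at \<open>\<pi> (y\<^sub>W - \<epsilon> x\<^sub>v)\<close>, so \<open>y\<^sub>W - \<epsilon> x\<^sub>v\<close>, which is in
  \<open>L\<close>, is not in \<open>K\<close>. Hence for some factor \<open>f\<close> the ray \<open>v\<close> does not depend on \<open>W\<close> in \<open>K\<^sub>f\<close>. Order
  the rays and colour each set of \<open>k + 1\<close> rays with a factor for which its last ray does not
  depend on the others. As the number of rays is arbitrarily large, Ramsey's theorem yields
  \<open>2k + 1\<close> rays, all of whose \<open>(k + 1)\<close>-subsets have the same colour \<open>f\<close>. Dependence is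
  monotone in \<open>W\<close>, so each of the last \<open>k + 1\<close> of these rays is independent, in \<open>K\<^sub>f\<close>, of those
  among them that precede it: the first \<open>k\<close> rays pad smaller sets up to size \<open>k\<close>
  (\<open>ramsey_dependent_element\<close>).

  This gives a chain of faces that is too long for a polynomial of degree at most \<open>k\<close>. The
  rank of a point \<open>x\<close>, the number of its nonzero eigenvalues, is at most the degree, and
  it increases from \<open>x\<close> to \<open>x + y\<close> if no \<open>x - \<epsilon> y\<close> is in the cone (\<open>hyp_rank_strict_mono\<close>).
  The last \<open>k + 1\<close> rays would thus make the rank at least \<open>k + 1\<close>.

  The properties of the rank rest on Garding's theory. For \<open>x\<close>, \<open>y\<close> in the cone, \<open>t \<mapsto> f (e + x + t y)\<close>
  has only negative real roots and is positive at \<open>0\<close>, so its coefficients are positive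
  (\<open>real_line_coeff_pos\<close>). This follows from two facts: a hyperbolic polynomial is
  hyperbolic with respect to every point with positive eigenvalues
  (\<open>hyperbolic_interior\<close>), and the cone is closed under addition (\<open>hyp_cone_add\<close>). Both are
  proved by moving the coefficients of a univariate polynomial along a segment: its roots move
  continuously, so they cannot enter an open set whose frontier they never meet
  (\<open>no_root_homotopy\<close>).
\<close>

section \<open>Substitution into polynomials\<close>

text \<open>Coefficients are mapped to the reals or to constant univariate polynomials; in both cases
  substitution is multiplicative, so that factors of \<open>p\<close> restrict to factors of its restrictions.\<close>

definition semiring_hom :: "('a::comm_semiring_1 \<Rightarrow> 'b::comm_semiring_1) \<Rightarrow> bool" where
  "semiring_hom h \<longleftrightarrow> h 0 = 0 \<and> h 1 = 1 \<and> (\<forall>a b. h (a + b) = h a + h b) \<and> (\<forall>a b. h (a * b) = h a * h b)"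

lemma semiring_hom_id: "semiring_hom (\<lambda>a. a)"
  and semiring_hom_const: "semiring_hom h \<Longrightarrow> semiring_hom (\<lambda>a. [:h a:])"
  by (auto simp: semiring_hom_def one_pCons mult.commute)

abbreviation mono_val :: "('q::finite \<Rightarrow> 'a::comm_semiring_1) \<Rightarrow> ('q \<Rightarrow>\<^sub>0 nat) \<Rightarrow> 'a" where
  "mono_val v m \<equiv> \<Prod>i\<in>UNIV. v i ^ Poly_Mapping.lookup m i"

lemma mono_val_add: "mono_val v (m + n) = mono_val v m * mono_val v n"
  by (simp add: lookup_add power_add prod.distrib)

lemma mono_val_scale: "mono_val (\<lambda>i. c * v i) m = c ^ monom_degree m * mono_val v m"
  by (simp add: power_mult_distrib prod.distrib monom_degree_def power_sum)

lemma mpoly_subst_superset: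
  assumes "h 0 = 0" "finite M" "Poly_Mapping.keys p \<subseteq> M"
  shows "mpoly_subst h p v = (\<Sum>m\<in>M. h (Poly_Mapping.lookup p m) * mono_val v m)"
  unfolding mpoly_subst_def using assms
  by (intro sum.mono_neutral_left) (auto simp: in_keys_iff)

lemma mpoly_subst_add:
  assumes "semiring_hom h"
  shows "mpoly_subst h (p + q) v = mpoly_subst h p v + mpoly_subst h q v"
proof -
  let ?M = "Poly_Mapping.keys p \<union> Poly_Mapping.keys q"
  have h: "h 0 = 0" "\<And>a b. h (a + b) = h a + h b" using assms by (auto simp: semiring_hom_def)
  show ?thesis
    by (simp add: mpoly_subst_superset[where M = ?M] h keys_add lookup_add sum.distrib distrib_right)
qed

lemma mpoly_subst_0 [simp]: "mpoly_subst h 0 v = 0"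
  by (simp add: mpoly_subst_def)

lemma mpoly_subst_sum:
  assumes "semiring_hom h"
  shows "mpoly_subst h (\<Sum>x\<in>A. f x) v = (\<Sum>x\<in>A. mpoly_subst h (f x) v)"
  by (induction A rule: infinite_finite_induct) (auto simp: mpoly_subst_add assms)

lemma mpoly_subst_single:
  assumes "semiring_hom h"
  shows "mpoly_subst h (Poly_Mapping.single m c) v = h c * mono_val v m"
  using assms by (subst mpoly_subst_superset[where M = "{m}"]) (auto simp: semiring_hom_def)

lemma mpoly_sum_singles:
  "(\<Sum>m\<in>Poly_Mapping.keys p. Poly_Mapping.single m (Poly_Mapping.lookup p m)) = p"
proof (rule poly_mapping_eqI)
  fix n
  have "(\<Sum>m\<in>Poly_Mapping.keys p. Poly_Mapping.lookup p m when m = n) =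
     (\<Sum>m\<in>Poly_Mapping.keys p. if m = n then Poly_Mapping.lookup p m else 0)"
    by (intro sum.cong) (auto simp: when_def)
  then show "Poly_Mapping.lookup (\<Sum>m\<in>Poly_Mapping.keys p. Poly_Mapping.single m (Poly_Mapping.lookup p m)) n
        = Poly_Mapping.lookup p n"
    by (simp add: lookup_sum lookup_single in_keys_iff)
qed

lemma mpoly_subst_mult:
  assumes h: "semiring_hom h"
  shows "mpoly_subst h (p * q) v = mpoly_subst h p v * mpoly_subst h q v"
proof -
  let ?s = "\<lambda>p m. Poly_Mapping.single m (Poly_Mapping.lookup p m)"
  have hm: "h (a * b) = h a * h b" for a b using h by (simp add: semiring_hom_def)
  have "p * q = (\<Sum>m\<in>Poly_Mapping.keys p. ?s p m) * (\<Sum>n\<in>Poly_Mapping.keys q. ?s q n)"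
    by (simp only: mpoly_sum_singles)
  also have "\<dots> = (\<Sum>m\<in>Poly_Mapping.keys p. \<Sum>n\<in>Poly_Mapping.keys q. ?s p m * ?s q n)"
    by (rule sum_product)
  finally have "mpoly_subst h (p * q) v =
      (\<Sum>m\<in>Poly_Mapping.keys p. \<Sum>n\<in>Poly_Mapping.keys q.
        (h (Poly_Mapping.lookup p m) * mono_val v m) * (h (Poly_Mapping.lookup q n) * mono_val v n))"
    by (simp add: mpoly_subst_sum[OF h] mult_single mpoly_subst_single[OF h] hm mono_val_add mult_ac)
  then show ?thesis by (simp add: sum_product mpoly_subst_def)
qed

lemma mpoly_subst_uminus:
  fixes v :: "'q::finite \<Rightarrow> 'a::comm_ring_1"
  assumes h: "semiring_hom h"
  shows "mpoly_subst h (- p) v = - mpoly_subst h p v"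
proof -
  have "mpoly_subst h p v + mpoly_subst h (- p) v = 0"
    by (simp flip: mpoly_subst_add[OF h])
  then show ?thesis by (simp add: add_eq_0_iff)
qed

lemma mpoly_eval_mult: "mpoly_eval (p * q) x = mpoly_eval p x * mpoly_eval q x"
  and mpoly_eval_uminus: "mpoly_eval (- p) x = - mpoly_eval p x"
  by (simp_all add: mpoly_eval_def mpoly_subst_mult mpoly_subst_uminus semiring_hom_id)

text \<open>The restriction of a polynomial to the line \<open>t \<mapsto> u + t w\<close>, as a univariate polynomial, for
  real and complex lines alike.\<close>

definition aff_poly :: "(real \<Rightarrow> 'a::comm_semiring_1) \<Rightarrow> 'q::finite mpoly \<Rightarrow> ('q \<Rightarrow> 'a) \<Rightarrow> ('q \<Rightarrow> 'a) \<Rightarrow> 'a poly" where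
  "aff_poly h p u w = mpoly_subst (\<lambda>a. [:h a:]) p (\<lambda>i. [:u i, w i:])"

lemma poly_aff_poly: "poly (aff_poly h p u w) t = mpoly_subst h p (\<lambda>i. u i + t * w i)"
  by (simp add: aff_poly_def mpoly_subst_def poly_sum poly_prod)

lemma aff_poly_mult:
  "semiring_hom h \<Longrightarrow> aff_poly h (p * q) u w = aff_poly h p u w * aff_poly h q u w"
  unfolding aff_poly_def by (intro mpoly_subst_mult semiring_hom_const)

definition real_line :: "'q::finite mpoly \<Rightarrow> real ^ 'q \<Rightarrow> real ^ 'q \<Rightarrow> real poly" where
  "real_line p u w = aff_poly (\<lambda>a. a) p (\<lambda>i. u $ i) (\<lambda>i. w $ i)"

lemma poly_real_line: "poly (real_line p u w) t = mpoly_eval p (u + t *\<^sub>R w)"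
  by (simp add: real_line_def poly_aff_poly mpoly_eval_def)

lemma real_line_mult: "real_line (p * q) u w = real_line p u w * real_line q u w"
  by (simp add: real_line_def aff_poly_mult semiring_hom_id)

lemma line_poly_real_line: "line_poly p e x = real_line p (- x) e"
  by (simp add: line_poly_def real_line_def aff_poly_def)

lemma line_poly_mult: "line_poly (p * q) e x = line_poly p e x * line_poly q e x"
  by (simp add: line_poly_real_line real_line_mult)

lemma map_poly_of_real_mult:
  "map_poly complex_of_real (f * g) = map_poly complex_of_real f * map_poly complex_of_real g"
  by (rule poly_eqI) (simp add: coeff_map_poly coeff_mult)

lemma real_rooted_factor: "real_rooted (f * g) \<Longrightarrow> real_rooted f"
  by (simp add: real_rooted_def map_poly_of_real_mult)

section \<open>Polynomials and their values\<close>

text \<open>Induction on the number of variables: a relation among monomials in the variables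
  \<open>insert j S\<close> is a polynomial identity in the \<open>j\<close>-th variable, and comparing its
  coefficients gives one relation in the variables \<open>S\<close> for each exponent of \<open>j\<close>.\<close>

lemma vanishing_sum_imp_group_sums_0:
  fixes c :: "('q \<Rightarrow>\<^sub>0 nat) \<Rightarrow> real"
  assumes "finite S" "finite M"
    and "\<And>x :: 'q \<Rightarrow> real. (\<Sum>m\<in>M. c m * (\<Prod>i\<in>S. x i ^ Poly_Mapping.lookup m i)) = 0"
  shows "(\<Sum>m\<in>{m\<in>M. \<forall>i\<in>S. Poly_Mapping.lookup m i = Poly_Mapping.lookup m0 i}. c m) = 0"
  using assms
proof (induction S arbitrary: M)
  case empty
  from empty(2)[of "\<lambda>_. 0"] show ?case by simp
next
  case (insert j S)
  let ?n = "Poly_Mapping.lookup m0 j"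
  let ?M = "{m\<in>M. Poly_Mapping.lookup m j = ?n}"
  have "(\<Sum>m\<in>?M. c m * (\<Prod>i\<in>S. x i ^ Poly_Mapping.lookup m i)) = 0" for x :: "'q \<Rightarrow> real"
  proof -
    let ?w = "\<lambda>m. c m * (\<Prod>i\<in>S. x i ^ Poly_Mapping.lookup m i)"
    define P where "P = (\<Sum>m\<in>M. monom (?w m) (Poly_Mapping.lookup m j))"
    have "poly P t = 0" for t
    proof -
      have "(\<Prod>i\<in>S. (x(j := t)) i ^ Poly_Mapping.lookup m i) = (\<Prod>i\<in>S. x i ^ Poly_Mapping.lookup m i)" for m
        using insert.hyps by (intro prod.cong) auto
      then show ?thesis
        using insert.prems(2)[of "x(j := t)"] insert.hyps
        by (simp add: P_def poly_sum poly_monom mult_ac)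
    qed
    then have "coeff P ?n = 0" by (metis poly_all_0_iff_0 coeff_0)
    then show ?thesis
      using insert.prems(1) by (simp add: P_def coeff_sum sum.If_cases Int_def)
  qed
  with insert.IH[of ?M] insert.prems(1) have
    "(\<Sum>m\<in>{m\<in>?M. \<forall>i\<in>S. Poly_Mapping.lookup m i = Poly_Mapping.lookup m0 i}. c m) = 0"
    by simp
  moreover have "{m\<in>?M. \<forall>i\<in>S. Poly_Mapping.lookup m i = Poly_Mapping.lookup m0 i} =
     {m\<in>M. \<forall>i\<in>insert j S. Poly_Mapping.lookup m i = Poly_Mapping.lookup m0 i}" by auto
  ultimately show ?case by simp
qed

lemma vanishing_sum_imp_coeffs_0:
  fixes c :: "('q::finite \<Rightarrow>\<^sub>0 nat) \<Rightarrow> real"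
  assumes "finite M" "\<And>x :: 'q \<Rightarrow> real. (\<Sum>m\<in>M. c m * mono_val x m) = 0" "m0 \<in> M"
  shows "c m0 = 0"
proof -
  have "{m\<in>M. \<forall>i\<in>UNIV. Poly_Mapping.lookup m i = Poly_Mapping.lookup m0 i} = {m0}"
    using assms(3) by (auto intro: poly_mapping_eqI)
  then show ?thesis
    using vanishing_sum_imp_group_sums_0[of UNIV M c m0] assms by simp
qed

section \<open>Homogeneity\<close>

definition homogeneous_of_degree :: "nat \<Rightarrow> 'q::finite mpoly \<Rightarrow> bool" where
  "homogeneous_of_degree d p \<longleftrightarrow> (\<forall>m\<in>Poly_Mapping.keys p. monom_degree m = d)"

lemma mpoly_subst_scale:
  assumes "homogeneous_of_degree d p"
  shows "mpoly_subst h p (\<lambda>i. c * v i) = c ^ d * mpoly_subst h p v"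
  using assms unfolding mpoly_subst_def sum_distrib_left
  by (intro sum.cong) (auto simp: mono_val_scale homogeneous_of_degree_def mult_ac)

lemma mpoly_eval_scale:
  assumes "homogeneous_of_degree d p"
  shows "mpoly_eval p (c *\<^sub>R x) = c ^ d * mpoly_eval p x"
  using mpoly_subst_scale[OF assms, of "\<lambda>a. a" c "\<lambda>i. x $ i"] by (simp add: mpoly_eval_def)

lemma mpoly_degree_homogeneous:
  assumes "homogeneous_of_degree d p" "mpoly_eval p x \<noteq> 0"
  shows "mpoly_degree p = d"
proof -
  have "Poly_Mapping.keys p \<noteq> {}" using assms(2) by (auto simp: mpoly_eval_def mpoly_subst_def)
  moreover have "\<And>m. m \<in> Poly_Mapping.keys p \<Longrightarrow> monom_degree m = d"
    using assms(1) by (auto simp: homogeneous_of_degree_def)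
  ultimately have "monom_degree ` Poly_Mapping.keys p = {d}" by blast
  then show ?thesis by (simp add: mpoly_degree_def)
qed

lemma prod_const_poly: "(\<Prod>i\<in>A. [:f i:]) = [:\<Prod>i\<in>A. f i:]"
  by (induction A rule: infinite_finite_induct) (simp_all add: one_pCons mult.commute)

text \<open>Restricting to a line through the origin separates the monomials of \<open>p\<close> by degree.\<close>

lemma coeff_ray:
  "coeff (real_line p 0 x) n =
    (\<Sum>m\<in>{m\<in>Poly_Mapping.keys p. monom_degree m = n}. Poly_Mapping.lookup p m * mono_val (\<lambda>i. x $ i) m)"
proof -
  have *: "(\<Prod>i\<in>UNIV. [:0, x $ i:] ^ Poly_Mapping.lookup m i) =
      monom (mono_val (\<lambda>i. x $ i) m) (monom_degree m)" for m :: "'a \<Rightarrow>\<^sub>0 nat"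
  proof -
    have "[:0, x $ i:] = [:0, 1:] * [:x $ i:]" for i by simp
    then have "(\<Prod>i\<in>UNIV. [:0, x $ i:] ^ Poly_Mapping.lookup m i) =
       [:0, 1:] ^ monom_degree m * (\<Prod>i\<in>UNIV. [:x $ i:] ^ Poly_Mapping.lookup m i)"
      using mono_val_scale[of "[:0, 1:]" "\<lambda>i. [:x $ i:]" m] by simp
    also have "(\<Prod>i\<in>UNIV. [:x $ i:] ^ Poly_Mapping.lookup m i) = [:mono_val (\<lambda>i. x $ i) m:]"
      by (simp add: poly_const_pow prod_const_poly)
    finally show ?thesis by (simp add: monom_altdef mult.commute)
  qed
  show ?thesis
    unfolding real_line_def aff_poly_def mpoly_subst_def coeff_sum
    using * by (simp add: if_distrib Int_def sum.If_cases cong: if_cong)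
qed

lemma poly_ext_real: "(\<And>t :: real. poly f t = poly g t) \<Longrightarrow> f = g"
  by (simp add: poly_eq_poly_eq_iff[symmetric] fun_eq_iff)

lemma ray_homogeneous:
  assumes "homogeneous_of_degree d p"
  shows "real_line p 0 x = monom (mpoly_eval p x) d"
  by (rule poly_ext_real) (simp add: poly_real_line mpoly_eval_scale[OF assms] poly_monom)

text \<open>The factors of \<open>c X\<^sup>d\<close> are monomials: the multiplicity of the root \<open>0\<close> is additive, as the degree
  is, and cannot exceed it, so the two agree for each factor.\<close>

lemma factor_of_monom:
  fixes f g :: "real poly"
  assumes "f * g = monom c d" "c \<noteq> 0"
  shows "degree f + degree g = d" "j \<noteq> degree f \<Longrightarrow> coeff f j = 0"
proof -
  have nz: "f \<noteq> 0" "g \<noteq> 0" using assms by (auto simp: monom_eq_0_iff)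
  show deg: "degree f + degree g = d"
    using assms degree_mult_eq[OF nz] by (simp add: degree_monom_eq)
  have "[:0, 1:] ^ d dvd f * g" using assms by (simp add: monom_altdef dvd_smult)
  then have "d \<le> order 0 f + order 0 g"
    using nz order_divides[of 0 d "f * g"] order_mult[of f g 0] by simp
  then have "degree f \<le> order 0 f"
    using deg order_degree[OF nz(1), of 0] order_degree[OF nz(2), of 0] by linarith
  then have "monom 1 (degree f) dvd f"
    using order_divides[of 0 "degree f" f] by (simp add: monom_altdef)
  then show "coeff f j = 0" if "j \<noteq> degree f"
    using that by (cases "j < degree f") (auto simp: monom_1_dvd_iff' coeff_eq_0)
qed

definition homogeneous_part :: "nat \<Rightarrow> 'q::finite mpoly \<Rightarrow> 'q mpoly" where
  "homogeneous_part j p =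
    (\<Sum>m\<in>{m\<in>Poly_Mapping.keys p. monom_degree m = j}. Poly_Mapping.single m (Poly_Mapping.lookup p m))"

lemma mpoly_eval_homogeneous_part:
  "mpoly_eval (homogeneous_part j p) x = coeff (real_line p 0 x) j"
  by (simp add: homogeneous_part_def mpoly_eval_def coeff_ray mpoly_subst_sum mpoly_subst_single
      semiring_hom_id)

lemma homogeneous_part_vanishes:
  assumes "\<And>x. mpoly_eval (homogeneous_part j p) x = 0" "m \<in> Poly_Mapping.keys p"
  shows "monom_degree m \<noteq> j"
proof
  assume "monom_degree m = j"
  let ?M = "{m\<in>Poly_Mapping.keys p. monom_degree m = j}"
  have "(\<Sum>m\<in>?M. Poly_Mapping.lookup p m * mono_val x m) = 0" for x :: "'a \<Rightarrow> real"
    using assms(1)[of "\<chi> i. x i"] by (simp add: mpoly_eval_homogeneous_part coeff_ray)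
  then have "Poly_Mapping.lookup p m = 0"
    using vanishing_sum_imp_coeffs_0[of ?M _ m] \<open>monom_degree m = j\<close> assms(2) by simp
  with assms(2) show False by (simp add: in_keys_iff)
qed

text \<open>Where \<open>f g\<close> does not vanish, its restriction to a ray is a monomial, hence so is that of
  \<open>f\<close>; so no two homogeneous parts of \<open>f\<close> are nonzero there. Near \<open>e\<close> this leaves the part whose
  degree is that of \<open>s \<mapsto> f (s e)\<close>, and each other part vanishes along every line through \<open>e\<close>.\<close>

lemma factor_homogeneous:
  fixes f g :: "'q::finite mpoly"
  assumes hom: "homogeneous_of_degree d (f * g)" and e: "mpoly_eval (f * g) e \<noteq> 0"
  shows "homogeneous_of_degree (degree (real_line f 0 e)) f"
    and "degree (real_line f 0 e) + degree (real_line g 0 e) = d"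
proof -
  have prod: "real_line f 0 x * real_line g 0 x = monom (mpoly_eval (f * g) x) d" for x
    using ray_homogeneous[OF hom] by (simp add: real_line_mult)
  from factor_of_monom(1)[OF prod e]
  show "degree (real_line f 0 e) + degree (real_line g 0 e) = d" .
  define n where "n = degree (real_line f 0 e)"
  have "mpoly_eval (homogeneous_part j f) y = 0" if "j \<noteq> n" for j y
  proof -
    define A where "A = real_line (homogeneous_part j f) e (y - e)"
    define B where "B = real_line (homogeneous_part n f) e (y - e)"
    define D where "D = real_line (f * g) e (y - e)"
    \<comment> \<open>Univariate polynomials form a domain, which spares a proof that the multivariate ones do.\<close>
    have "poly (A * B * D) t = 0" for t
    proof (cases "mpoly_eval (f * g) (e + t *\<^sub>R (y - e)) = 0")
      case True
      then show ?thesis by (simp add: D_def poly_real_line)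
    next
      case False
      let ?R = "real_line f 0 (e + t *\<^sub>R (y - e))"
      have "coeff ?R j = 0 \<or> coeff ?R n = 0"
        using factor_of_monom(2)[OF prod False] \<open>j \<noteq> n\<close> by (cases "degree ?R = j") auto
      then show ?thesis
        by (auto simp: A_def B_def poly_real_line mpoly_eval_homogeneous_part)
    qed
    then have "A * B * D = 0" by (metis poly_all_0_iff_0)
    moreover have "poly D 0 \<noteq> 0" using e by (simp add: D_def poly_real_line)
    moreover have "poly B 0 \<noteq> 0"
    proof -
      have "real_line f 0 e \<noteq> 0" using prod[of e] e by (auto simp: monom_eq_0_iff)
      then show ?thesis by (simp add: B_def poly_real_line mpoly_eval_homogeneous_part n_def)
    qed
    ultimately have "A = 0" by auto
    then have "poly A 1 = 0" by simp
    then show ?thesis by (simp add: A_def poly_real_line)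
  qed
  then show "homogeneous_of_degree (degree (real_line f 0 e)) f"
    using homogeneous_part_vanishes by (force simp: homogeneous_of_degree_def n_def)
qed

text \<open>Together with the additivity of degrees this bounds the length of a factorization into
  nonunits, so that irreducible factors exist.\<close>

lemma homogeneous_of_degree_0_is_unit:
  assumes "homogeneous_of_degree 0 f" "mpoly_eval f e \<noteq> 0"
  shows "f dvd 1"
proof -
  have z: "m = 0" if "m \<in> Poly_Mapping.keys f" for m
  proof -
    have "monom_degree m = 0" using assms(1) that by (simp add: homogeneous_of_degree_def)
    then show ?thesis by (intro poly_mapping_eqI) (simp add: monom_degree_def)
  qed
  let ?c = "Poly_Mapping.lookup f 0"
  have f: "f = Poly_Mapping.single 0 ?c"
    using z by (intro poly_mapping_eqI) (auto simp: lookup_single when_def in_keys_iff)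
  then have "?c \<noteq> 0" using assms(2) by (auto simp: mpoly_eval_def)
  then have "Poly_Mapping.single 0 ?c * Poly_Mapping.single 0 (1 / ?c) = (1 :: 'a mpoly)"
    by (simp add: mult_single)
  with f show ?thesis by (metis dvdI)
qed

section \<open>Hyperbolic polynomials with factors of low degree\<close>

lemma homogeneous_mpoly_iff: "homogeneous_mpoly p \<longleftrightarrow> (\<exists>d. homogeneous_of_degree d p)"
  by (simp add: homogeneous_mpoly_def homogeneous_of_degree_def)

lemma hyperbolic_homogeneous_of_degree:
  assumes "hyperbolic p e"
  shows "homogeneous_of_degree (mpoly_degree p) p"
proof -
  obtain d where d: "homogeneous_of_degree d p"
    using assms by (auto simp: hyperbolic_def homogeneous_mpoly_iff)
  with mpoly_degree_homogeneous[OF this, of e] assms show ?thesis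
    by (simp add: hyperbolic_def)
qed

lemma hyperbolic_factor:
  assumes "hyperbolic (f * g) e" "mpoly_eval f e > 0"
  shows "hyperbolic f e"
  unfolding hyperbolic_def homogeneous_mpoly_iff
proof (intro conjI allI)
  show "\<exists>d. homogeneous_of_degree d f"
    using factor_homogeneous(1)[OF hyperbolic_homogeneous_of_degree[OF assms(1)], of e] assms(1)
    by (auto simp: hyperbolic_def)
  show "real_rooted (line_poly f e x)" for x
    using assms(1) by (auto simp: hyperbolic_def line_poly_mult dest: real_rooted_factor)
qed (fact assms(2))

lemma hyperbolic_factor_degrees:
  assumes "hyperbolic (f * g) e" "mpoly_eval f e > 0"
  shows "mpoly_degree f + mpoly_degree g = mpoly_degree (f * g)"
proof -
  have h: "homogeneous_of_degree (mpoly_degree (f * g)) (f * g)" "mpoly_eval (f * g) e \<noteq> 0"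
    using hyperbolic_homogeneous_of_degree[OF assms(1)] assms(1) by (auto simp: hyperbolic_def)
  then have "mpoly_eval f e \<noteq> 0" "mpoly_eval g e \<noteq> 0" by (auto simp: mpoly_eval_mult)
  then show ?thesis
    using factor_homogeneous[OF h] factor_homogeneous(1)[of _ g f e] h
      mpoly_degree_homogeneous by (metis mult.commute)
qed

lemma hyp_cone_mult: "hyp_cone (f * g) e = hyp_cone f e \<inter> hyp_cone g e"
  by (auto simp: hyp_cone_def hyp_eigenvalues_def line_poly_mult)

lemma hyperbolic_unit_degree:
  assumes "hyperbolic p e" "p dvd 1"
  shows "mpoly_degree p = 0"
proof -
  obtain q where q: "1 = p * q" using assms(2) by (auto simp: dvd_def)
  have h: "homogeneous_of_degree 0 (p * q)"
    by (auto simp: q[symmetric] homogeneous_of_degree_def monom_degree_def)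
  have e: "mpoly_eval (p * q) e \<noteq> 0"
    using mpoly_subst_single[OF semiring_hom_id, of 0 1 "\<lambda>i. e $ i"]
    by (simp add: q[symmetric] mpoly_eval_def)
  show ?thesis
    using factor_homogeneous[OF h e] mpoly_degree_homogeneous[of 0 p e] assms(1)
    by (simp add: hyperbolic_def)
qed

text \<open>The eigenvalues for a product are those for its factors, so splitting \<open>p\<close> repeatedly
  writes its cone as an intersection. A factor may be negative at \<open>e\<close>; then both factors are
  negated.\<close>

lemma hyp_cone_as_intersection:
  assumes "hyperbolic p e"
    and "\<And>f. irreducible f \<Longrightarrow> f dvd p \<Longrightarrow> mpoly_degree f \<le> k"
  obtains F where "finite F" "\<And>f. f \<in> F \<Longrightarrow> hyperbolic f e" "\<And>f. f \<in> F \<Longrightarrow> mpoly_degree f \<le> k"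
    "hyp_cone p e = (\<Inter>f\<in>F. hyp_cone f e)"
proof -
  have "\<exists>F. finite F \<and> (\<forall>f\<in>F. hyperbolic f e \<and> mpoly_degree f \<le> k) \<and>
      hyp_cone p e = (\<Inter>f\<in>F. hyp_cone f e)"
    using assms
  proof (induction "mpoly_degree p" arbitrary: p rule: less_induct)
    case less
    show ?case
    proof (cases "irreducible p \<or> mpoly_degree p = 0")
      case True
      with less.prems(1) less.prems(2)[of p] have "mpoly_degree p \<le> k" by auto
      with less.prems(1) show ?thesis by (intro exI[of _ "{p}"]) simp
    next
      case False
      have "p \<noteq> 0" using less.prems(1) by (auto simp: hyperbolic_def mpoly_eval_def)
      moreover have "\<not> p dvd 1" using False hyperbolic_unit_degree[OF less.prems(1)] by auto
      ultimately obtain a' b' where ab': "p = a' * b'" "\<not> a' dvd 1" "\<not> b' dvd 1"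
        using False by (auto simp: irreducible_def)
      \<comment> \<open>Hyperbolicity asks for a positive value at \<open>e\<close>, hence the choice of signs.\<close>
      obtain a b where ab: "p = a * b" "\<not> a dvd 1" "\<not> b dvd 1"
        and pos: "mpoly_eval a e > 0" "mpoly_eval b e > 0"
      proof (cases "mpoly_eval a' e > 0")
        case True
        with that[of a' b'] ab' less.prems(1) show ?thesis
          by (simp add: hyperbolic_def mpoly_eval_mult zero_less_mult_iff)
      next
        case False
        with that[of "- a'" "- b'"] ab' less.prems(1) show ?thesis
          by (simp add: hyperbolic_def mpoly_eval_mult mpoly_eval_uminus zero_less_mult_iff)
      qed
      have hyp: "hyperbolic a e" "hyperbolic b e"
        using hyperbolic_factor[of a b e] hyperbolic_factor[of b a e] pos less.prems(1) ab(1)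
        by (simp_all add: mult.commute)
      have "mpoly_degree a \<noteq> 0" "mpoly_degree b \<noteq> 0"
        using hyp[THEN hyperbolic_homogeneous_of_degree] ab pos homogeneous_of_degree_0_is_unit
        by (metis less_irrefl)+
      then have "mpoly_degree a < mpoly_degree p" "mpoly_degree b < mpoly_degree p"
        using hyperbolic_factor_degrees[of a b e] pos less.prems(1) ab(1) by auto
      moreover have "mpoly_degree f \<le> k" if "irreducible f" "f dvd a \<or> f dvd b" for f
        using less.prems(2)[OF that(1)] that(2) ab(1) by auto
      ultimately obtain F G where
        "finite F" "\<forall>f\<in>F. hyperbolic f e \<and> mpoly_degree f \<le> k" "hyp_cone a e = (\<Inter>f\<in>F. hyp_cone f e)"
        "finite G" "\<forall>f\<in>G. hyperbolic f e \<and> mpoly_degree f \<le> k" "hyp_cone b e = (\<Inter>f\<in>G. hyp_cone f e)"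
        using less.hyps[of a] less.hyps[of b] hyp by metis
      then show ?thesis
        by (intro exI[of _ "F \<union> G"]) (auto simp: ab(1) hyp_cone_mult)
    qed
  qed
  then show thesis using that by blast
qed

section \<open>Complex values\<close>

definition ceval :: "'q::finite mpoly \<Rightarrow> ('q \<Rightarrow> complex) \<Rightarrow> complex" where
  "ceval p z = mpoly_subst complex_of_real p z"

definition cvec :: "real ^ 'q \<Rightarrow> 'q \<Rightarrow> complex" where
  "cvec x i = complex_of_real (x $ i)"

lemma cvec_add: "cvec (x + y) i = cvec x i + cvec y i"
  and cvec_scaleR: "cvec (c *\<^sub>R x) i = complex_of_real c * cvec x i"
  by (simp_all add: cvec_def)

lemma ceval_cvec: "ceval p (cvec x) = complex_of_real (mpoly_eval p x)"
  by (simp add: ceval_def cvec_def mpoly_eval_def mpoly_subst_def)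

lemma ceval_cnj: "ceval p (\<lambda>i. cnj (z i)) = cnj (ceval p z)"
  by (simp add: ceval_def mpoly_subst_def)

lemma ceval_scale:
  "homogeneous_of_degree d p \<Longrightarrow> ceval p (\<lambda>i. c * z i) = c ^ d * ceval p z"
  unfolding ceval_def by (rule mpoly_subst_scale)

lemma continuous_on_ceval [continuous_intros]:
  assumes "\<And>i. continuous_on S (\<lambda>x. z x i)"
  shows "continuous_on S (\<lambda>x. ceval p (z x))"
  unfolding ceval_def mpoly_subst_def by (intro continuous_intros assms)

definition complex_line :: "'q::finite mpoly \<Rightarrow> ('q \<Rightarrow> complex) \<Rightarrow> ('q \<Rightarrow> complex) \<Rightarrow> complex poly" where
  "complex_line p u w = aff_poly complex_of_real p u w"

lemma poly_complex_line: "poly (complex_line p u w) t = ceval p (\<lambda>i. u i + t * w i)"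
  by (simp add: complex_line_def poly_aff_poly ceval_def)

lemma complex_poly_eqI_reals:
  assumes "\<And>t :: real. poly f (of_real t) = poly g (of_real t :: complex)"
  shows "f = g"
proof (rule ccontr)
  assume "f \<noteq> g"
  then have "finite {z. poly (f - g) z = 0}" by (intro poly_roots_finite) simp
  moreover have "range complex_of_real \<subseteq> {z. poly (f - g) z = 0}" using assms by auto
  moreover have "infinite (range complex_of_real)"
    by (simp add: finite_image_iff inj_of_real infinite_UNIV_char_0)
  ultimately show False using finite_subset by blast
qed

lemma poly_map_poly_of_real:
  "poly (map_poly complex_of_real f) (of_real t) = of_real (poly f t)"
  by (induction f) (auto simp: map_poly_pCons)

lemma map_poly_real_line: "map_poly complex_of_real (real_line p u w) = complex_line p (cvec u) (cvec w)"
proof (rule complex_poly_eqI_reals)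
  fix t :: real
  show "poly (map_poly complex_of_real (real_line p u w)) (of_real t)
      = poly (complex_line p (cvec u) (cvec w)) (of_real t)"
    using ceval_cvec[of p "u + t *\<^sub>R w"]
    by (simp add: poly_complex_line poly_real_line cvec_def[abs_def] poly_map_poly_of_real)
qed

text \<open>Hyperbolicity in the form used below: \<open>t e + x\<close> is not a zero of \<open>p\<close> for real \<open>x\<close> and
  nonreal \<open>t\<close>.\<close>

lemma hyperbolic_root_real:
  assumes "hyperbolic p e" "ceval p (\<lambda>i. t * cvec e i + cvec x i) = 0"
  shows "t \<in> \<real>"
proof -
  have "real_rooted (line_poly p e (- x))" using assms(1) by (simp add: hyperbolic_def)
  then show ?thesis using assms(2)
    by (simp add: real_rooted_def line_poly_real_line map_poly_real_line poly_complex_line add.commute)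
qed

lemma coeff_mult_degree_le:
  assumes "degree f \<le> m" "degree g \<le> n"
  shows "coeff (f * g) (m + n) = coeff f m * (coeff g n :: 'a::comm_semiring_1)"
proof -
  have "coeff (f * g) (m + n) = (\<Sum>i\<le>m + n. coeff f i * coeff g (m + n - i))" by (rule coeff_mult)
  also have "\<dots> = (\<Sum>i\<in>{m}. coeff f i * coeff g (m + n - i))"
  proof (rule sum.mono_neutral_right)
    show "\<forall>i\<in>{..m + n} - {m}. coeff f i * coeff g (m + n - i) = 0"
    proof
      fix i assume "i \<in> {..m + n} - {m}"
      then consider "i > m" | "m + n - i > n" by fastforce
      then show "coeff f i * coeff g (m + n - i) = 0"
        using assms by cases (simp_all add: coeff_eq_0)
    qed
  qed auto
  finally show ?thesis by simp
qed

lemma degree_coeff_power_linear: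
  fixes a b :: "'a::comm_semiring_1"
  shows "degree ([:a, b:] ^ k) \<le> k \<and> coeff ([:a, b:] ^ k) k = b ^ k"
proof (induction k)
  case (Suc k)
  have 1: "degree [:a, b:] \<le> 1" by simp
  show ?case
  proof
    show "degree ([:a, b:] ^ Suc k) \<le> Suc k"
      unfolding power_Suc using degree_mult_le[of "[:a, b:]" "[:a, b:] ^ k"] Suc 1 by linarith
    show "coeff ([:a, b:] ^ Suc k) (Suc k) = b ^ Suc k"
      using coeff_mult_degree_le[OF 1 conjunct1[OF Suc]] Suc
      by (simp only: power_Suc plus_1_eq_Suc) (simp add: numeral_eq_Suc)
  qed
qed simp

lemma degree_coeff_prod_power_linear:
  fixes a b :: "'q \<Rightarrow> 'a::comm_semiring_1"
  assumes "finite A"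
  shows "degree (\<Prod>i\<in>A. [:a i, b i:] ^ m i) \<le> sum m A \<and>
    coeff (\<Prod>i\<in>A. [:a i, b i:] ^ m i) (sum m A) = (\<Prod>i\<in>A. b i ^ m i)"
  using assms
proof induction
  case (insert j A)
  let ?Q = "\<Prod>i\<in>A. [:a i, b i:] ^ m i"
  show ?case
    using insert degree_coeff_power_linear[of "a j" "b j" "m j"]
      coeff_mult_degree_le[of "[:a j, b j:] ^ m j" "m j" ?Q "sum m A"]
      degree_mult_le[of "[:a j, b j:] ^ m j" ?Q] by simp
qed simp

text \<open>The leading coefficient of \<open>t \<mapsto> p (u + t a)\<close> is \<open>p a\<close>, whatever \<open>u\<close> is. So when \<open>u\<close> varies,
  no root escapes to infinity.\<close>

lemma complex_line_degree_le:
  assumes "homogeneous_of_degree d p"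
  shows "degree (complex_line p u a) \<le> d" "coeff (complex_line p u a) d = ceval p a"
proof -
  note * = degree_coeff_prod_power_linear[of UNIV u a, folded monom_degree_def]
  have m: "monom_degree m = d" if "m \<in> Poly_Mapping.keys p" for m
    using assms that by (simp add: homogeneous_of_degree_def)
  show "degree (complex_line p u a) \<le> d"
    unfolding complex_line_def aff_poly_def mpoly_subst_def using * m
    by (intro degree_sum_le) (auto simp: monom_degree_def intro: order_trans[OF degree_smult_le])
  show "coeff (complex_line p u a) d = ceval p a"
    unfolding complex_line_def aff_poly_def mpoly_subst_def ceval_def coeff_sum using * m
    by (intro sum.cong) (auto simp: monom_degree_def)
qed

lemma complex_line_degree:
  assumes "homogeneous_of_degree d p" "ceval p a \<noteq> 0"
  shows "degree (complex_line p u a) = d" "lead_coeff (complex_line p u a) = ceval p a"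
proof -
  show "degree (complex_line p u a) = d"
    using complex_line_degree_le[OF assms(1), of u a] assms(2)
    by (metis le_antisym le_degree)
  then show "lead_coeff (complex_line p u a) = ceval p a"
    using complex_line_degree_le[OF assms(1), of u a] by simp
qed

section \<open>Continuity of roots\<close>

text \<open>The value at \<open>z0\<close> is the leading coefficient times the product of the differences of
  \<open>z0\<close> and the roots.\<close>

lemma norm_poly_ge_dist_to_roots:
  fixes P :: "complex poly"
  assumes "0 \<le> r" "\<And>z. poly P z = 0 \<Longrightarrow> r \<le> cmod (z0 - z)"
  shows "cmod (lead_coeff P) * r ^ degree P \<le> cmod (poly P z0)"
  using assms(2)
proof (induction "degree P" arbitrary: P)
  case 0
  then obtain c where "P = [:c:]" by (metis degree_eq_zeroE)
  then show ?case by simp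
next
  case (Suc n)
  then obtain z where z: "poly P z = 0"
    using alg_closed_imp_poly_has_root[of P] by auto
  then obtain Q where Q: "P = [:- z, 1:] * Q" by (auto simp: poly_eq_0_iff_dvd)
  have nz: "Q \<noteq> 0" using Suc.hyps(2) Q by auto
  then have deg: "degree P = Suc (degree Q)" unfolding Q by (subst degree_mult_eq) auto
  then have "cmod (lead_coeff Q) * r ^ degree Q \<le> cmod (poly Q z0)"
    using Suc.hyps Suc.prems Q by auto
  moreover have "r \<le> cmod (z0 - z)" using Suc.prems z by simp
  ultimately have "(cmod (lead_coeff Q) * r ^ degree Q) * r \<le> cmod (poly Q z0) * cmod (z0 - z)"
    using assms(1) by (intro mult_mono) auto
  moreover have "lead_coeff P = lead_coeff Q" unfolding Q by (subst lead_coeff_mult) simp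
  moreover have "poly P z0 = (z0 - z) * poly Q z0" unfolding Q by (simp add: algebra_simps)
  ultimately show ?case by (simp add: deg norm_mult mult_ac)
qed

text \<open>If the roots for the parameter \<open>\<theta>\<close> were all at distance at least \<open>r\<close> from \<open>z0\<close>, then the value at
  \<open>z0\<close> would be bounded away from zero, but it tends to zero as \<open>\<theta>\<close> tends to \<open>\<theta>0\<close>.\<close>

lemma root_persists:
  assumes hom: "homogeneous_of_degree d p" and a: "ceval p a \<noteq> 0"
    and U: "open U" and zU: "z0 \<in> U" and z0: "ceval p (\<lambda>i. u i + of_real \<theta>0 * w i + z0 * a i) = 0"
  obtains \<delta> where "\<delta> > 0"
    "\<And>\<theta>. \<bar>\<theta> - \<theta>0\<bar> < \<delta> \<Longrightarrow> \<exists>z\<in>U. ceval p (\<lambda>i. u i + of_real \<theta> * w i + z * a i) = 0"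
proof -
  obtain r where r: "r > 0" "ball z0 r \<subseteq> U" using U zU by (meson openE)
  let ?f = "\<lambda>\<theta> z. ceval p (\<lambda>i. u i + of_real \<theta> * w i + z * a i)"
  have "continuous_on UNIV (\<lambda>\<theta>. ?f \<theta> z0)" by (intro continuous_intros)
  moreover have "cmod (ceval p a) * r ^ d > 0" using a r by simp
  ultimately obtain \<delta> where \<delta>: "\<delta> > 0"
    "\<And>\<theta>. dist \<theta> \<theta>0 < \<delta> \<Longrightarrow> dist (?f \<theta> z0) (?f \<theta>0 z0) < cmod (ceval p a) * r ^ d"
    unfolding continuous_on_iff by (meson UNIV_I)
  have "\<exists>z\<in>U. ?f \<theta> z = 0" if "\<bar>\<theta> - \<theta>0\<bar> < \<delta>" for \<theta>
  proof (rule ccontr)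
    assume no: "\<not> (\<exists>z\<in>U. ?f \<theta> z = 0)"
    let ?P = "complex_line p (\<lambda>i. u i + of_real \<theta> * w i) a"
    have "r \<le> cmod (z0 - z)" if "poly ?P z = 0" for z
    proof (rule ccontr)
      assume "\<not> r \<le> cmod (z0 - z)"
      then have "z \<in> U" using r by (auto simp: dist_norm)
      with no that show False by (simp add: poly_complex_line)
    qed
    then have "cmod (ceval p a) * r ^ d \<le> cmod (poly ?P z0)"
      using norm_poly_ge_dist_to_roots[of r ?P z0] r
      by (simp add: complex_line_degree(1)[OF hom a] complex_line_degree_le(2)[OF hom])
    with \<delta>(2)[of \<theta>] that z0 show False by (simp add: poly_complex_line dist_norm)
  qed
  then show thesis by (rule that[OF \<delta>(1)])
qed

text \<open>By homogeneity a root \<open>t\<close> is a zero of \<open>p\<close> at \<open>a + t\<^sup>-\<^sup>1 (u + \<theta> w)\<close>, and this point is near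
  \<open>a\<close>, where \<open>p\<close> does not vanish, if \<open>t\<close> is large.\<close>

lemma roots_bounded:
  fixes u w a :: "'q::finite \<Rightarrow> complex"
  assumes hom: "homogeneous_of_degree d p" and a: "ceval p a \<noteq> 0"
  obtains B where "\<And>\<theta> t. \<theta> \<in> {0..1} \<Longrightarrow> ceval p (\<lambda>i. u i + of_real \<theta> * w i + t * a i) = 0 \<Longrightarrow> cmod t \<le> B"
proof -
  let ?g = "\<lambda>x :: real \<times> complex. ceval p (\<lambda>i. snd x * (u i + of_real (fst x) * w i) + a i)"
  have "uniformly_continuous_on ({0..1} \<times> cball 0 1) ?g"
    by (intro compact_uniformly_continuous continuous_intros compact_Times) auto
  then obtain \<delta> where \<delta>: "\<delta> > 0" "\<And>x y. x \<in> {0..1} \<times> cball 0 1 \<Longrightarrow> y \<in> {0..1} \<times> cball 0 1 \<Longrightarrow>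
      dist y x < \<delta> \<Longrightarrow> dist (?g y) (?g x) < cmod (ceval p a)"
    unfolding uniformly_continuous_on_def using a by (meson zero_less_norm_iff)
  have "cmod t \<le> max 1 (1 / \<delta>)"
    if \<theta>: "\<theta> \<in> {0..1}" and t: "ceval p (\<lambda>i. u i + of_real \<theta> * w i + t * a i) = 0" for \<theta> t
  proof (rule ccontr)
    assume "\<not> cmod t \<le> max 1 (1 / \<delta>)"
    then have big: "cmod t > 1" "cmod t > 1 / \<delta>" by auto
    then have "t \<noteq> 0" by auto
    then have "?g (\<theta>, 1 / t) = ceval p (\<lambda>i. (1 / t) * (u i + of_real \<theta> * w i + t * a i))"
      by (simp add: field_simps)
    also have "\<dots> = 0" unfolding ceval_scale[OF hom] t by simp
    finally have "?g (\<theta>, 1 / t) = 0" .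
    moreover have "cmod (1 / t) < \<delta>" "cmod (1 / t) \<le> 1"
      using big \<delta>(1) by (simp_all add: norm_divide divide_simps mult.commute)
    ultimately show False
      using \<delta>(2)[of "(\<theta>, 0)" "(\<theta>, 1 / t)"] \<theta> by (simp add: dist_Pair_Pair dist_norm)
  qed
  then show thesis by (rule that)
qed

text \<open>The parameters \<open>\<theta>\<close> for which there is a root in \<open>U\<close> form an open subset of \<open>[0, 1]\<close> because
  roots persist, and a closed one because bounded roots in \<open>U\<close> accumulate at a root in the closure
  of \<open>U\<close>, which by assumption is not on the frontier.\<close>

lemma no_root_homotopy:
  fixes u w a :: "'q::finite \<Rightarrow> complex"
  assumes hom: "homogeneous_of_degree d p" and a: "ceval p a \<noteq> 0" and U: "open U"
    and frontier: "\<And>\<theta> t. 0 \<le> \<theta> \<Longrightarrow> \<theta> \<le> 1 \<Longrightarrow> t \<in> frontier U \<Longrightarrow>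
       ceval p (\<lambda>i. u i + of_real \<theta> * w i + t * a i) \<noteq> 0"
    and start: "\<And>t. t \<in> U \<Longrightarrow> ceval p (\<lambda>i. u i + t * a i) \<noteq> 0"
    and t: "t \<in> U"
  shows "ceval p (\<lambda>i. u i + w i + t * a i) \<noteq> 0"
proof -
  define f where "f \<theta> z = ceval p (\<lambda>i. u i + of_real \<theta> * w i + z * a i)" for \<theta> :: real and z
  define A where "A = {\<theta>\<in>{0..1}. \<exists>z\<in>U. f \<theta> z = 0}"
  have "openin (top_of_set {0..1}) A"
    unfolding openin_euclidean_subtopology_iff
  proof (intro conjI ballI)
    fix \<theta>0 assume "\<theta>0 \<in> A"
    then obtain z0 where "z0 \<in> U" "f \<theta>0 z0 = 0" by (auto simp: A_def)
    from root_persists[OF hom a U this[unfolded f_def]] obtain \<delta> where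
      "\<delta> > 0" "\<And>\<theta>. \<bar>\<theta> - \<theta>0\<bar> < \<delta> \<Longrightarrow> \<exists>z\<in>U. f \<theta> z = 0" unfolding f_def by metis
    then show "\<exists>e>0. \<forall>\<theta>\<in>{0..1}. dist \<theta> \<theta>0 < e \<longrightarrow> \<theta> \<in> A"
      by (auto simp: A_def dist_real_def)
  qed (auto simp: A_def)
  moreover have "closedin (top_of_set {0..1}) A"
  proof -
    obtain B where B: "\<And>\<theta> t. \<theta> \<in> {0..1} \<Longrightarrow> f \<theta> t = 0 \<Longrightarrow> cmod t \<le> B"
      using roots_bounded[OF hom a, of u w] unfolding f_def by metis
    define K where "K = {0..1::real} \<times> (cball 0 B \<inter> closure U)"
    define Z where "Z = {x \<in> K. f (fst x) (snd x) = 0}"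
    have "compact K" unfolding K_def by (intro compact_Times compact_Int_closed) auto
    moreover have "closedin (top_of_set K) Z"
      unfolding Z_def f_def by (intro continuous_closedin_preimage_constant continuous_intros)
    ultimately have "compact Z" using closedin_compact by blast
    then have "compact (fst ` Z)" by (intro compact_continuous_image continuous_intros)
    moreover have "A = fst ` Z"
    proof
      show "A \<subseteq> fst ` Z"
      proof
        fix \<theta> assume "\<theta> \<in> A"
        then obtain z where "\<theta> \<in> {0..1}" "z \<in> U" "f \<theta> z = 0" by (auto simp: A_def)
        then have "(\<theta>, z) \<in> Z" using B closure_subset[of U] by (auto simp: Z_def K_def)
        then show "\<theta> \<in> fst ` Z" by force
      qed
      show "fst ` Z \<subseteq> A"
      proof
        fix \<theta> assume "\<theta> \<in> fst ` Z"
        then obtain z where z: "\<theta> \<in> {0..1}" "z \<in> closure U" "f \<theta> z = 0"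
          by (auto simp: Z_def K_def)
        then have "z \<notin> frontier U" using frontier unfolding f_def by auto
        with z U show "\<theta> \<in> A" by (auto simp: A_def frontier_def interior_open)
      qed
    qed
    ultimately have "closed A" by (simp add: compact_imp_closed)
    then show ?thesis by (intro closed_subset) (auto simp: A_def)
  qed
  ultimately have "A = {} \<or> A = {0..1}"
    using connected_Icc[of "0::real" 1] unfolding connected_clopen by blast
  moreover have "0 \<notin> A" using start by (auto simp: A_def f_def)
  ultimately have "1 \<notin> A" by auto
  with t show ?thesis by (auto simp: A_def f_def)
qed

section \<open>Hyperbolicity cones\<close>

definition hyp_interior :: "'q::finite mpoly \<Rightarrow> real ^ 'q \<Rightarrow> (real ^ 'q) set" where
  "hyp_interior p e = {x. \<forall>t\<in>hyp_eigenvalues p e x. t > 0}"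

lemma hyperbolicD:
  assumes "hyperbolic p e"
  shows "mpoly_eval p e > 0" "homogeneous_of_degree (mpoly_degree p) p"
  using assms hyperbolic_homogeneous_of_degree by (auto simp: hyperbolic_def)

lemma hyp_eigenvalues_iff:
  assumes "hyperbolic p e"
  shows "t \<in> hyp_eigenvalues p e x \<longleftrightarrow> mpoly_eval p ((- t) *\<^sub>R e + x) = 0"
proof -
  have "t *\<^sub>R e - x = (- 1) *\<^sub>R ((- t) *\<^sub>R e + x)" by simp
  then show ?thesis
    unfolding hyp_eigenvalues_def poly_line_poly mem_Collect_eq
    by (simp only: mpoly_eval_scale[OF hyperbolicD(2)[OF assms]]) simp
qed

lemma mem_hyp_cone_iff:
  assumes "hyperbolic p e"
  shows "x \<in> hyp_cone p e \<longleftrightarrow> (\<forall>t>0. mpoly_eval p (t *\<^sub>R e + x) \<noteq> 0)"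
proof
  assume x: "x \<in> hyp_cone p e"
  show "\<forall>t>0. mpoly_eval p (t *\<^sub>R e + x) \<noteq> 0"
  proof (intro allI impI notI)
    fix t :: real assume t: "t > 0" "mpoly_eval p (t *\<^sub>R e + x) = 0"
    then have "- t \<in> hyp_eigenvalues p e x" unfolding hyp_eigenvalues_iff[OF assms] by simp
    then have "- t \<ge> 0" using x unfolding hyp_cone_def by blast
    with t(1) show False by simp
  qed
next
  assume x: "\<forall>t>0. mpoly_eval p (t *\<^sub>R e + x) \<noteq> 0"
  have "t \<ge> 0" if "t \<in> hyp_eigenvalues p e x" for t
  proof (rule ccontr)
    assume "\<not> t \<ge> 0"
    then have "- t > 0" by simp
    with x that show False unfolding hyp_eigenvalues_iff[OF assms] by blast
  qed
  then show "x \<in> hyp_cone p e" unfolding hyp_cone_def by blast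
qed

lemma mem_hyp_interior_iff:
  assumes "hyperbolic p e"
  shows "x \<in> hyp_interior p e \<longleftrightarrow> (\<forall>t\<ge>0. mpoly_eval p (t *\<^sub>R e + x) \<noteq> 0)"
proof
  assume x: "x \<in> hyp_interior p e"
  show "\<forall>t\<ge>0. mpoly_eval p (t *\<^sub>R e + x) \<noteq> 0"
  proof (intro allI impI notI)
    fix t :: real assume t: "t \<ge> 0" "mpoly_eval p (t *\<^sub>R e + x) = 0"
    then have "- t \<in> hyp_eigenvalues p e x" unfolding hyp_eigenvalues_iff[OF assms] by simp
    then have "- t > 0" using x unfolding hyp_interior_def by blast
    with t(1) show False by simp
  qed
next
  assume x: "\<forall>t\<ge>0. mpoly_eval p (t *\<^sub>R e + x) \<noteq> 0"
  have "t > 0" if "t \<in> hyp_eigenvalues p e x" for t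
  proof (rule ccontr)
    assume "\<not> t > 0"
    then have "- t \<ge> 0" by simp
    with x that show False unfolding hyp_eigenvalues_iff[OF assms] by blast
  qed
  then show "x \<in> hyp_interior p e" unfolding hyp_interior_def by blast
qed

lemma hyp_interior_subset: "hyperbolic p e \<Longrightarrow> x \<in> hyp_interior p e \<Longrightarrow> x \<in> hyp_cone p e"
  by (simp add: mem_hyp_cone_iff mem_hyp_interior_iff)

lemma hyp_cone_scale:
  assumes p: "hyperbolic p e" and x: "x \<in> hyp_cone p e" and c: "c \<ge> 0"
  shows "c *\<^sub>R x \<in> hyp_cone p e"
  unfolding mem_hyp_cone_iff[OF p]
proof (intro allI impI)
  fix t :: real assume t: "t > 0"
  note hom = mpoly_eval_scale[OF hyperbolicD(2)[OF p]]
  show "mpoly_eval p (t *\<^sub>R e + c *\<^sub>R x) \<noteq> 0"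
  proof (cases "c = 0")
    case True
    then show ?thesis using t hyperbolicD(1)[OF p] by (simp add: hom)
  next
    case False
    have "t *\<^sub>R e + c *\<^sub>R x = c *\<^sub>R ((t / c) *\<^sub>R e + x)" using False by (simp add: scaleR_add_right)
    then have "mpoly_eval p (t *\<^sub>R e + c *\<^sub>R x) = c ^ mpoly_degree p * mpoly_eval p ((t / c) *\<^sub>R e + x)"
      by (simp only: hom)
    then show ?thesis using x t c False by (simp add: mem_hyp_cone_iff[OF p])
  qed
qed

lemma zero_mem_hyp_cone: "hyperbolic p e \<Longrightarrow> 0 \<in> hyp_cone p e"
  using mpoly_eval_scale[OF hyperbolicD(2)] hyperbolicD(1) by (fastforce simp: mem_hyp_cone_iff)

lemma hyp_cone_add_direction:
  assumes "hyperbolic p e" "x \<in> hyp_cone p e" "c > 0"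
  shows "c *\<^sub>R e + x \<in> hyp_interior p e"
  unfolding mem_hyp_interior_iff[OF assms(1)]
proof (intro allI impI)
  fix t :: real assume "t \<ge> 0"
  then have "mpoly_eval p ((t + c) *\<^sub>R e + x) \<noteq> 0"
    using assms by (simp add: mem_hyp_cone_iff)
  then show "mpoly_eval p (t *\<^sub>R e + (c *\<^sub>R e + x)) \<noteq> 0"
    by (simp add: scaleR_add_left add.assoc)
qed

text \<open>There is no zero on the segment from \<open>e\<close>, where \<open>p\<close> is positive, to \<open>e + x\<close>.\<close>

lemma eval_pos_of_hyp_cone:
  assumes p: "hyperbolic p e" and x: "x \<in> hyp_cone p e"
  shows "mpoly_eval p (e + x) > 0"
proof (rule ccontr)
  assume "\<not> mpoly_eval p (e + x) > 0"
  moreover have "mpoly_eval p (e + x) \<noteq> 0" using x by (auto simp: mem_hyp_cone_iff[OF p] dest: spec[of _ 1])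
  ultimately have "poly (real_line p e x) 1 < 0" by (simp add: poly_real_line)
  moreover have "poly (real_line p e x) 0 > 0" using hyperbolicD(1)[OF p] by (simp add: poly_real_line)
  ultimately obtain s where s: "s > 0" "poly (real_line p e x) s = 0"
    using poly_IVT[of 0 1 "real_line p e x"] by (auto simp: mult_less_0_iff)
  moreover have "s *\<^sub>R x \<in> hyp_cone p e" using hyp_cone_scale[OF p x] s by simp
  ultimately show False
    unfolding mem_hyp_cone_iff[OF p] poly_real_line by (auto dest: spec[of _ 1])
qed

lemma eval_pos_of_hyp_interior:
  assumes p: "hyperbolic p e" and x: "x \<in> hyp_interior p e"
  shows "mpoly_eval p x > 0"
proof (rule ccontr)
  let ?g = "real_line p x e"
  have nz: "poly ?g t \<noteq> 0" if "t \<ge> 0" for t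
    using x that by (simp add: mem_hyp_interior_iff[OF p] poly_real_line add.commute)
  assume "\<not> mpoly_eval p x > 0"
  then have "poly ?g 0 < 0" using nz[of 0] by (simp add: poly_real_line)
  moreover have "poly ?g 1 > 0"
    using eval_pos_of_hyp_cone[OF p hyp_interior_subset[OF p x]] by (simp add: poly_real_line add.commute)
  ultimately obtain t where "t > 0" "poly ?g t = 0"
    using poly_IVT[of 0 1 ?g] by (auto simp: mult_less_0_iff)
  with nz[of t] show False by simp
qed

lemma cvec_line: "cvec (u + t *\<^sub>R w) = (\<lambda>i. cvec u i + of_real t * cvec w i)"
  by (simp add: cvec_def[abs_def])

text \<open>For real \<open>t\<close> the point is \<open>i \<alpha> e\<close> plus a real vector, hence not a zero. So the roots \<open>t\<close> do not
  cross the real axis when \<open>u\<close> shrinks to \<open>0\<close>. There they are \<open>i \<alpha> / r\<close> with \<open>r\<close> the negative of an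
  eigenvalue of \<open>a\<close>, thus in the lower half plane.\<close>

lemma stable_in_upper_half_plane:
  assumes p: "hyperbolic p e" and a: "a \<in> hyp_interior p e" and \<alpha>: "\<alpha> > 0" and t: "Im t \<ge> 0"
  shows "ceval p (\<lambda>i. \<i> * of_real \<alpha> * cvec e i + cvec u i + t * cvec a i) \<noteq> 0"
proof -
  note hom = hyperbolicD(2)[OF p]
  have real: "ceval p (\<lambda>i. \<i> * of_real \<alpha> * cvec e i + cvec v i + of_real r * cvec a i) \<noteq> 0" for v r
  proof
    assume "ceval p (\<lambda>i. \<i> * of_real \<alpha> * cvec e i + cvec v i + of_real r * cvec a i) = 0"
    then have "ceval p (\<lambda>i. \<i> * of_real \<alpha> * cvec e i + cvec (v + r *\<^sub>R a) i) = 0"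
      by (simp add: cvec_line add.assoc)
    from hyperbolic_root_real[OF p this] \<alpha> show False by (simp add: complex_is_Real_iff)
  qed
  have a0: "ceval p (cvec a) \<noteq> 0" using eval_pos_of_hyp_interior[OF p a] by (simp add: ceval_cvec)
  show ?thesis
  proof (cases "Im t = 0")
    case True
    then have "t = of_real (Re t)" by (simp add: complex_eq_iff)
    then show ?thesis using real by metis
  next
    case False
    let ?U = "{z. Im z > 0}"
    show ?thesis
    proof (rule no_root_homotopy[OF hom a0, of ?U])
      show "open ?U" by (rule open_halfspace_Im_gt)
      show "t \<in> ?U" using t False by simp
    next
      fix \<theta> :: real and z assume "z \<in> frontier ?U"
      moreover have "frontier ?U = {z. Im z = 0}" using frontier_halfspace_gt[of \<i> 0] by (simp add: inner_complex_def)
      ultimately have "z = of_real (Re z)" by (simp add: complex_eq_iff)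
      then show "ceval p (\<lambda>i. \<i> * of_real \<alpha> * cvec e i + of_real \<theta> * cvec u i + z * cvec a i) \<noteq> 0"
        using real[of "\<theta> *\<^sub>R u" "Re z"] by (simp add: cvec_scaleR)
    next
      fix z assume z: "z \<in> ?U"
      then have "z \<noteq> 0" by auto
      show "ceval p (\<lambda>i. \<i> * of_real \<alpha> * cvec e i + z * cvec a i) \<noteq> 0"
      proof
        assume "ceval p (\<lambda>i. \<i> * of_real \<alpha> * cvec e i + z * cvec a i) = 0"
        moreover have "(\<lambda>i. \<i> * of_real \<alpha> * cvec e i + z * cvec a i) =
            (\<lambda>i. z * (\<i> * of_real \<alpha> / z * cvec e i + cvec a i))"
          using \<open>z \<noteq> 0\<close> by (simp add: distrib_left)
        ultimately have 0: "ceval p (\<lambda>i. \<i> * of_real \<alpha> / z * cvec e i + cvec a i) = 0"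
          using \<open>z \<noteq> 0\<close> by (simp only: ceval_scale[OF hom]) simp
        from hyperbolic_root_real[OF p this] obtain r where r: "\<i> * of_real \<alpha> / z = of_real r"
          by (auto elim: Reals_cases)
        then have "ceval p (cvec (a + r *\<^sub>R e)) = 0"
          using 0 by (simp add: cvec_line add.commute)
        then have "r < 0"
          using a by (fastforce simp: ceval_cvec mem_hyp_interior_iff[OF p] add.commute not_le[symmetric])
        moreover have "\<i> * of_real \<alpha> = of_real r * z" using r \<open>z \<noteq> 0\<close> by (simp add: divide_eq_eq)
        then have "\<alpha> = r * Im z" by (simp add: complex_eq_iff)
        ultimately show False using z \<alpha> mult_neg_pos[of r "Im z"] by simp
      qed
    qed
  qed
qed

text \<open>The limit \<open>\<alpha> \<rightarrow> 0\<close> of the previous lemma: a root of \<open>t \<mapsto> p (u + t a)\<close> in the open upper half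
  plane would persist for small \<open>\<alpha> > 0\<close>. Complex conjugation excludes the lower half plane.\<close>

lemma hyperbolic_interior:
  assumes p: "hyperbolic p e" and a: "a \<in> hyp_interior p e"
  shows "hyperbolic p a"
proof -
  note hom = hyperbolicD(2)[OF p]
  have a_pos: "mpoly_eval p a > 0" by (rule eval_pos_of_hyp_interior[OF p a])
  then have a0: "ceval p (cvec a) \<noteq> 0" by (simp add: ceval_cvec)
  have no_upper: "Im z \<le> 0" if z: "ceval p (\<lambda>i. cvec u i + z * cvec a i) = 0" for u z
  proof (rule ccontr)
    assume "\<not> Im z \<le> 0"
    then have zU: "z \<in> {z. Im z > 0}" by simp
    have "ceval p (\<lambda>i. cvec u i + of_real 0 * (\<i> * cvec e i) + z * cvec a i) = 0" using z by simp
    from root_persists[OF hom a0 open_halfspace_Im_gt zU this] obtain \<delta> where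
      \<delta>: "\<delta> > 0" "\<And>\<theta>. \<bar>\<theta> - 0\<bar> < \<delta> \<Longrightarrow> \<exists>z\<in>{z. Im z > 0}.
        ceval p (\<lambda>i. cvec u i + of_real \<theta> * (\<i> * cvec e i) + z * cvec a i) = 0" by metis
    from \<delta>(2)[of "\<delta> / 2"] \<delta>(1) obtain w where w: "Im w > 0"
      "ceval p (\<lambda>i. cvec u i + of_real (\<delta> / 2) * (\<i> * cvec e i) + w * cvec a i) = 0" by auto
    then have "ceval p (\<lambda>i. \<i> * of_real (\<delta> / 2) * cvec e i + cvec u i + w * cvec a i) = 0"
      by (simp add: algebra_simps)
    with stable_in_upper_half_plane[OF p a, of "\<delta> / 2" w u] \<delta>(1) w(1) show False by simp
  qed
  have "real_rooted (line_poly p a x)" for x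
    unfolding real_rooted_def line_poly_real_line map_poly_real_line poly_complex_line
  proof (intro allI impI)
    fix z assume z: "ceval p (\<lambda>i. cvec (- x) i + z * cvec a i) = 0"
    have "ceval p (\<lambda>i. cvec (- x) i + cnj z * cvec a i) = cnj (ceval p (\<lambda>i. cvec (- x) i + z * cvec a i))"
      by (simp add: ceval_cnj[symmetric] cvec_def)
    with z have "ceval p (\<lambda>i. cvec (- x) i + cnj z * cvec a i) = 0" by simp
    from no_upper[OF z] no_upper[OF this] show "z \<in> \<real>" by (simp add: complex_is_Real_iff)
  qed
  then show ?thesis using p a_pos by (simp add: hyperbolic_def)
qed

text \<open>The roots of \<open>t \<mapsto> p (e + \<theta> x + t b)\<close> are real, because \<open>p\<close> is hyperbolic with respect to \<open>b\<close>,
  and nonzero, because \<open>p (e + \<theta> x) > 0\<close>. They are negative for \<open>\<theta> = 0\<close>, so they remain negative up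
  to \<open>\<theta> = 1\<close>.\<close>

lemma eval_nonzero_on_cone_of_sums:
  assumes p: "hyperbolic p e" and x: "x \<in> hyp_cone p e" and b: "b \<in> hyp_interior p e" and t: "t > 0"
  shows "mpoly_eval p (e + x + t *\<^sub>R b) \<noteq> 0"
proof -
  note hom = hyperbolicD(2)[OF p]
  have b0: "ceval p (cvec b) \<noteq> 0" using eval_pos_of_hyp_interior[OF p b] by (simp add: ceval_cvec)
  let ?U = "{z. Re z > 0}"
  have real: "z = of_real (Re z)" if "ceval p (\<lambda>i. cvec v i + z * cvec b i) = 0" for z v
    using hyperbolic_root_real[OF hyperbolic_interior[OF p b], of z v] that
    by (simp add: add.commute complex_is_Real_iff complex_eq_iff)
  have "ceval p (\<lambda>i. cvec e i + cvec x i + of_real t * cvec b i) \<noteq> 0"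
  proof (rule no_root_homotopy[OF hom b0, of ?U])
    show "open ?U" by (rule open_halfspace_Re_gt)
    show "of_real t \<in> ?U" using t by simp
  next
    fix \<theta> :: real and z assume \<theta>: "0 \<le> \<theta>" and "z \<in> frontier ?U"
    moreover have "frontier ?U = {z. Re z = 0}" using frontier_halfspace_gt[of "1 :: complex" 0] by (simp add: inner_complex_def)
    ultimately have z: "Re z = 0" by simp
    show "ceval p (\<lambda>i. cvec e i + of_real \<theta> * cvec x i + z * cvec b i) \<noteq> 0"
    proof
      assume *: "ceval p (\<lambda>i. cvec e i + of_real \<theta> * cvec x i + z * cvec b i) = 0"
      have "z = of_real (Re z)"
        by (rule real[of "e + \<theta> *\<^sub>R x"]) (use * in \<open>simp add: cvec_line\<close>)
      then have "mpoly_eval p (e + \<theta> *\<^sub>R x) = 0"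
        using * z ceval_cvec[of p "e + \<theta> *\<^sub>R x"] by (simp add: cvec_line)
      then show False using eval_pos_of_hyp_cone[OF p hyp_cone_scale[OF p x \<theta>]] by simp
    qed
  next
    fix z assume z: "z \<in> ?U"
    show "ceval p (\<lambda>i. cvec e i + z * cvec b i) \<noteq> 0"
    proof
      assume *: "ceval p (\<lambda>i. cvec e i + z * cvec b i) = 0"
      then have "ceval p (cvec (e + Re z *\<^sub>R b)) = 0" using real[OF *] by (simp add: cvec_line)
      moreover have "mpoly_eval p (e + Re z *\<^sub>R b) > 0"
        using z by (intro eval_pos_of_hyp_cone[OF p] hyp_cone_scale[OF p] hyp_interior_subset[OF p b]) simp
      ultimately show False by (simp add: ceval_cvec)
    qed
  qed
  then show ?thesis
    using ceval_cvec[of p "(e + x) + t *\<^sub>R b"] unfolding cvec_line cvec_add by simp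
qed

lemma hyp_cone_add:
  assumes p: "hyperbolic p e" and x: "x \<in> hyp_cone p e" and y: "y \<in> hyp_cone p e"
  shows "x + y \<in> hyp_cone p e"
  unfolding mem_hyp_cone_iff[OF p]
proof (intro allI impI)
  fix t :: real assume t: "t > 0"
  \<comment> \<open>Half of \<open>t e\<close> moves \<open>y\<close> to a point with positive eigenvalues.\<close>
  define b where "b = (t / 2) *\<^sub>R e + y"
  have "b \<in> hyp_interior p e" unfolding b_def using hyp_cone_add_direction[OF p y] t by simp
  moreover have "(2 / t) *\<^sub>R x \<in> hyp_cone p e" using hyp_cone_scale[OF p x] t by simp
  ultimately have "mpoly_eval p (e + (2 / t) *\<^sub>R x + (2 / t) *\<^sub>R b) \<noteq> 0"
    using eval_nonzero_on_cone_of_sums[OF p] t by simp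
  moreover have "t *\<^sub>R e = (t / 2) *\<^sub>R e + (t / 2) *\<^sub>R e" by (simp flip: scaleR_add_left)
  then have "t *\<^sub>R e + (x + y) = (t / 2) *\<^sub>R (e + (2 / t) *\<^sub>R x + (2 / t) *\<^sub>R b)"
    using t by (simp add: b_def scaleR_add_right)
  ultimately show "mpoly_eval p (t *\<^sub>R e + (x + y)) \<noteq> 0"
    using t by (simp only: mpoly_eval_scale[OF hyperbolicD(2)[OF p]]) simp
qed

section \<open>The rank of a point of a hyperbolicity cone\<close>

text \<open>If \<open>p\<close> is hyperbolic and \<open>\<lambda>\<^sub>1, \<dots>, \<lambda>\<^sub>d\<close> are the eigenvalues of \<open>x\<close>, then \<open>p (e + s x) = p e \<Prod>\<^sub>j (1 + s \<lambda>\<^sub>j)\<close>, so this degree is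
  the number of nonzero eigenvalues, counted with multiplicity.\<close>

definition hyp_rank :: "'q::finite mpoly \<Rightarrow> real ^ 'q \<Rightarrow> real ^ 'q \<Rightarrow> nat" where
  "hyp_rank p e x = degree (real_line p e x)"

lemma degree_map_poly_of_real: "degree (map_poly complex_of_real f) = degree f"
  by (simp add: degree_map_poly)

lemma hyp_rank_le:
  assumes "hyperbolic p e"
  shows "hyp_rank p e x \<le> mpoly_degree p"
  using complex_line_degree_le(1)[OF hyperbolicD(2)[OF assms], of "cvec e" "cvec x"]
  by (simp add: hyp_rank_def map_poly_real_line[symmetric] degree_map_poly_of_real)

text \<open>Such a polynomial is a positive constant times a product of factors \<open>X - r\<close> with \<open>r < 0\<close>.\<close>

lemma real_rooted_coeffs_pos:
  assumes "real_rooted f" "poly f 0 > 0" "\<And>t. t \<ge> 0 \<Longrightarrow> poly f t \<noteq> 0" "n \<le> degree f"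
  shows "coeff f n > 0"
  using assms
proof (induction "degree f" arbitrary: f n)
  case 0
  then have "n = 0" by simp
  then show ?case using "0.prems"(2) by (simp add: poly_0_coeff_0)
next
  case (Suc m)
  have "degree (map_poly complex_of_real f) > 0" using Suc.hyps(2) by (simp add: degree_map_poly_of_real)
  then obtain z where z: "poly (map_poly complex_of_real f) z = 0"
    using alg_closed_imp_poly_has_root by blast
  with Suc.prems(1) obtain r where "z = of_real r" unfolding real_rooted_def by (auto elim: Reals_cases)
  with z have r: "poly f r = 0" by (simp add: poly_map_poly_of_real)
  then have r_neg: "r < 0" using Suc.prems(3)[of r] by linarith
  obtain g where g: "f = [:- r, 1:] * g" using r by (auto simp: poly_eq_0_iff_dvd)
  then have "g \<noteq> 0" using Suc.prems(2) by auto
  then have deg: "degree f = Suc (degree g)" unfolding g by (subst degree_mult_eq) auto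
  have IH: "coeff g j > 0" if "j \<le> degree g" for j
  proof (rule Suc.hyps(1))
    show "m = degree g" using deg Suc.hyps(2) by simp
    show "real_rooted g" using Suc.prems(1) real_rooted_factor[of g "[:- r, 1:]"] g by (simp add: mult.commute)
    show "poly g 0 > 0" using Suc.prems(2) r_neg unfolding g by (simp add: mult_less_0_iff)
    show "poly g t \<noteq> 0" if "t \<ge> 0" for t using Suc.prems(3)[OF that] unfolding g by auto
  qed (fact that)
  have coeff: "coeff f n = - r * coeff g n + (case n of 0 \<Rightarrow> 0 | Suc j \<Rightarrow> coeff g j)"
    unfolding g by (simp add: coeff_pCons split: nat.split)
  show ?case
  proof (cases n)
    case 0
    then show ?thesis using coeff IH[of 0] r_neg by (simp add: mult_neg_pos)
  next
    case (Suc j)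
    then have "coeff g j > 0" using IH Suc.prems(4) deg by simp
    moreover have "coeff g n \<ge> 0" using IH[of n] by (cases "n \<le> degree g") (auto simp: coeff_eq_0 less_imp_le)
    then have "r * coeff g n \<le> 0" using r_neg by (simp add: mult_nonpos_nonneg)
    ultimately show ?thesis using coeff Suc by simp
  qed
qed

text \<open>The direction \<open>e + x\<close> has positive eigenvalues, so \<open>p\<close> is hyperbolic with respect to it, and the
  roots \<open>z\<close> of \<open>p (e + x + z y)\<close>, whose inverses are the roots of \<open>w \<mapsto> p (w (e + x) + y)\<close>, are real.
  They are negative because \<open>x + t y\<close> is in the cone for \<open>t \<ge> 0\<close>.\<close>

lemma real_line_coeff_pos:
  assumes p: "hyperbolic p e" and x: "x \<in> hyp_cone p e" and y: "y \<in> hyp_cone p e"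
    and n: "n \<le> degree (real_line p (e + x) y)"
  shows "coeff (real_line p (e + x) y) n > 0"
proof (rule real_rooted_coeffs_pos[OF _ _ _ n])
  note hom = hyperbolicD(2)[OF p]
  have pos: "mpoly_eval p (e + x) > 0" by (rule eval_pos_of_hyp_cone[OF p x])
  then show "poly (real_line p (e + x) y) 0 > 0" by (simp add: poly_real_line)
  show "poly (real_line p (e + x) y) t \<noteq> 0" if "t \<ge> 0" for t
    using eval_pos_of_hyp_cone[OF p hyp_cone_add[OF p x hyp_cone_scale[OF p y that]]]
    by (simp add: poly_real_line add.assoc)
  have hyp: "hyperbolic p (e + x)"
    using hyperbolic_interior[OF p hyp_cone_add_direction[OF p x, of 1]] by simp
  show "real_rooted (real_line p (e + x) y)"
    unfolding real_rooted_def map_poly_real_line poly_complex_line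
  proof (intro allI impI)
    fix z assume z: "ceval p (\<lambda>i. cvec (e + x) i + z * cvec y i) = 0"
    have "z \<noteq> 0" using z pos by (auto simp: ceval_cvec)
    then have "(\<lambda>i. cvec (e + x) i + z * cvec y i) = (\<lambda>i. z * (1 / z * cvec (e + x) i + cvec y i))"
      by (simp add: distrib_left)
    then have "ceval p (\<lambda>i. 1 / z * cvec (e + x) i + cvec y i) = 0"
      using z \<open>z \<noteq> 0\<close> by (simp only: ceval_scale[OF hom]) simp
    from hyperbolic_root_real[OF hyp this] have "1 / (1 / z) \<in> \<real>" by (rule Reals_divide[OF Reals_1])
    then show "z \<in> \<real>" by (simp only: divide_divide_eq_right mult_1 div_by_1)
  qed
qed

lemma poly_mono_of_coeffs_nonneg:
  fixes f :: "real poly"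
  assumes "\<And>n. coeff f n \<ge> 0" "0 \<le> t"
  shows "poly f 0 \<le> poly f t"
proof -
  have "coeff f 0 * t ^ 0 \<le> (\<Sum>i\<le>degree f. coeff f i * t ^ i)"
    using assms by (intro member_le_sum) auto
  then show ?thesis by (simp add: poly_altdef[of f t] poly_0_coeff_0)
qed

lemma degree_le_of_poly_le:
  fixes f g :: "real poly"
  assumes "lead_coeff f > 0" "\<And>t. t \<ge> 0 \<Longrightarrow> poly f t \<le> poly g t"
  shows "degree f \<le> degree g"
proof (rule ccontr)
  assume less: "\<not> degree f \<le> degree g"
  have "lead_coeff (f - g) > 0"
  proof -
    have "degree (f - g) = degree f"
      using degree_add_eq_left[of "- g" f] less by simp
    then show ?thesis using assms(1) less by (simp add: coeff_eq_0)
  qed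
  moreover obtain n where "\<forall>t\<ge>n. poly (f - g) t \<ge> lead_coeff (f - g)"
    using poly_pinfty_gt_lc[OF calculation] by blast
  ultimately have "poly (f - g) (max n 0) > 0" by (meson less_le_trans max.cobounded1)
  with assms(2)[of "max n 0"] show False by simp
qed

lemma real_line_from_direction_coeff_pos:
  assumes "hyperbolic p e" "x \<in> hyp_cone p e" "n \<le> hyp_rank p e x"
  shows "coeff (real_line p e x) n > 0"
  using real_line_coeff_pos[OF assms(1) zero_mem_hyp_cone[OF assms(1)] assms(2)] assms(3)
  by (simp add: hyp_rank_def)

text \<open>For \<open>s \<ge> 0\<close>, \<open>p (e + s x + t y)\<close> increases with \<open>t \<ge> 0\<close>. At \<open>t = s\<close> this bounds
  \<open>p (e + s x)\<close> by \<open>p (e + s (x + y))\<close>, and the growth as \<open>s \<rightarrow> \<infinity>\<close> compares the degrees.\<close>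

lemma hyp_rank_mono:
  assumes p: "hyperbolic p e" and x: "x \<in> hyp_cone p e" and y: "y \<in> hyp_cone p e"
  shows "hyp_rank p e x \<le> hyp_rank p e (x + y)"
  unfolding hyp_rank_def
proof (rule degree_le_of_poly_le)
  show "lead_coeff (real_line p e x) > 0" using real_line_from_direction_coeff_pos[OF p x] by (simp add: hyp_rank_def)
  fix t :: real assume t: "t \<ge> 0"
  let ?g = "real_line p (e + t *\<^sub>R x) y"
  have "coeff ?g n \<ge> 0" for n
    using real_line_coeff_pos[OF p hyp_cone_scale[OF p x t] y, of n]
    by (cases "n \<le> degree ?g") (auto simp: coeff_eq_0)
  from poly_mono_of_coeffs_nonneg[OF this t]
  show "poly (real_line p e x) t \<le> poly (real_line p e (x + y)) t"
    by (simp add: poly_real_line algebra_simps)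
qed

text \<open>That the coefficients of \<open>s \<mapsto> p (e + s (x + t y))\<close> are polynomials in \<open>t\<close> makes them continuous in \<open>t\<close>,
  and identically zero once they vanish on an interval.\<close>

definition polynomial_family :: "(real \<Rightarrow> real poly) \<Rightarrow> bool" where
  "polynomial_family P \<longleftrightarrow> (\<forall>n. \<exists>q. \<forall>t. coeff (P t) n = poly q t)"

lemma polynomial_family_const: "polynomial_family (\<lambda>t. f)"
  unfolding polynomial_family_def
proof
  show "\<exists>q. \<forall>t. coeff f n = poly q t" for n by (rule exI[of _ "[:coeff f n:]"]) simp
qed

lemma polynomial_family_add:
  assumes "polynomial_family P" "polynomial_family Q"
  shows "polynomial_family (\<lambda>t. P t + Q t)"
  unfolding polynomial_family_def
proof
  fix n
  obtain q r where "\<And>t. coeff (P t) n = poly q t" "\<And>t. coeff (Q t) n = poly r t"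
    using assms unfolding polynomial_family_def by metis
  then show "\<exists>q. \<forall>t. coeff (P t + Q t) n = poly q t" by (intro exI[of _ "q + r"]) simp
qed

lemma polynomial_family_mult:
  assumes "polynomial_family P" "polynomial_family Q"
  shows "polynomial_family (\<lambda>t. P t * Q t)"
  unfolding polynomial_family_def
proof
  fix n
  obtain q r where "\<And>n t. coeff (P t) n = poly (q n) t" "\<And>n t. coeff (Q t) n = poly (r n) t"
    using assms unfolding polynomial_family_def by metis
  then show "\<exists>q. \<forall>t. coeff (P t * Q t) n = poly q t"
    by (intro exI[of _ "\<Sum>i\<le>n. q i * r (n - i)"]) (simp add: coeff_mult poly_sum)
qed

lemma polynomial_family_sum:
  "(\<And>i. i \<in> A \<Longrightarrow> polynomial_family (P i)) \<Longrightarrow> polynomial_family (\<lambda>t. \<Sum>i\<in>A. P i t)"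
  by (induction A rule: infinite_finite_induct)
    (simp_all add: polynomial_family_const polynomial_family_add)

lemma polynomial_family_prod:
  "(\<And>i. i \<in> A \<Longrightarrow> polynomial_family (P i)) \<Longrightarrow> polynomial_family (\<lambda>t. \<Prod>i\<in>A. P i t)"
  by (induction A rule: infinite_finite_induct)
    (simp_all add: polynomial_family_const polynomial_family_mult)

lemma polynomial_family_power: "polynomial_family P \<Longrightarrow> polynomial_family (\<lambda>t. P t ^ n)"
  by (induction n) (simp_all add: polynomial_family_const polynomial_family_mult)

lemma polynomial_family_linear: "polynomial_family (\<lambda>t. [:c, a + t * b:])"
  unfolding polynomial_family_def
proof
  fix n :: nat
  have "\<forall>t. coeff [:c, a + t * b:] n = poly (if n = 0 then [:c:] else if n = 1 then [:a, b:] else 0) t"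
    by (auto simp: coeff_pCons split: nat.split)
  then show "\<exists>q. \<forall>t. coeff [:c, a + t * b:] n = poly q t" by blast
qed

lemma coeff_real_line_polynomial:
  obtains q where "\<And>n t. coeff (real_line p e (x + t *\<^sub>R y)) n = poly (q n) t"
proof -
  have "polynomial_family (\<lambda>t. real_line p e (x + t *\<^sub>R y))"
    unfolding real_line_def aff_poly_def mpoly_subst_def vector_add_component vector_scaleR_component
      real_scaleR_def
    by (intro polynomial_family_sum polynomial_family_mult polynomial_family_prod
        polynomial_family_power polynomial_family_const polynomial_family_linear)
  then show thesis using that unfolding polynomial_family_def by metis
qed

lemma mem_hyp_cone_of_coeffs:
  assumes p: "hyperbolic p e" and c: "\<And>n. coeff (real_line p e x) n \<ge> 0"
  shows "x \<in> hyp_cone p e"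
  unfolding mem_hyp_cone_iff[OF p]
proof (intro allI impI)
  fix t :: real assume t: "t > 0"
  have "poly (real_line p e x) 0 \<le> poly (real_line p e x) (1 / t)"
    using t by (intro poly_mono_of_coeffs_nonneg c) simp
  then have "mpoly_eval p (e + (1 / t) *\<^sub>R x) > 0"
    using hyperbolicD(1)[OF p] by (simp add: poly_real_line)
  moreover have "t *\<^sub>R e + x = t *\<^sub>R (e + (1 / t) *\<^sub>R x)" using t by (simp add: scaleR_add_right)
  ultimately show "mpoly_eval p (t *\<^sub>R e + x) \<noteq> 0"
    using t by (simp only: mpoly_eval_scale[OF hyperbolicD(2)[OF p]]) simp
qed

text \<open>Consider the coefficients of \<open>s \<mapsto> p (e + s (x + t y))\<close> as polynomials in \<open>t\<close>. If \<open>x\<close> and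
  \<open>x + y\<close> have the same rank \<open>k\<close>, then by monotonicity the rank is at most \<open>k\<close> for all \<open>t \<in> [0, 1]\<close>, so
  the coefficients beyond the \<open>k\<close>-th vanish identically. Those up to the \<open>k\<close>-th are positive at
  \<open>t = 0\<close>, hence also at \<open>t = - \<epsilon>\<close> for small \<open>\<epsilon>\<close>. So all coefficients at \<open>t = - \<epsilon>\<close> are nonnegative,
  and \<open>x - \<epsilon> y\<close> is in the cone.\<close>

lemma hyp_rank_strict_mono:
  assumes p: "hyperbolic p e" and x: "x \<in> hyp_cone p e" and y: "y \<in> hyp_cone p e"
    and no: "\<not> (\<exists>\<epsilon>>0. x - \<epsilon> *\<^sub>R y \<in> hyp_cone p e)"
  shows "hyp_rank p e x < hyp_rank p e (x + y)"
proof (rule ccontr)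
  define k where "k = hyp_rank p e x"
  assume "\<not> hyp_rank p e x < hyp_rank p e (x + y)"
  then have k: "hyp_rank p e (x + y) \<le> k" by (simp add: k_def)
  obtain q where q: "\<And>n t. coeff (real_line p e (x + t *\<^sub>R y)) n = poly (q n) t"
    using coeff_real_line_polynomial[of p e x y] by metis
  have q0: "q n = 0" if n: "n > k" for n
  proof (rule ccontr)
    assume "q n \<noteq> 0"
    then have "finite {t. poly (q n) t = 0}" by (rule poly_roots_finite)
    moreover have "{0..1} \<subseteq> {t. poly (q n) t = 0}"
    proof
      fix t :: real assume t: "t \<in> {0..1}"
      have "hyp_rank p e (x + t *\<^sub>R y) \<le> hyp_rank p e ((x + t *\<^sub>R y) + (1 - t) *\<^sub>R y)"
        using t by (intro hyp_rank_mono[OF p] hyp_cone_add[OF p] hyp_cone_scale[OF p] x y) auto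
      then have "degree (real_line p e (x + t *\<^sub>R y)) < n" using k n by (simp add: hyp_rank_def algebra_simps)
      then show "t \<in> {t. poly (q n) t = 0}" using q coeff_eq_0 by (metis mem_Collect_eq)
    qed
    ultimately have "finite {0..1::real}" using finite_subset by blast
    then show False by (simp add: infinite_Icc)
  qed
  have "eventually (\<lambda>\<epsilon>. poly (q n) (- \<epsilon>) > 0) (at_right 0)" if "n \<le> k" for n
  proof -
    have "((\<lambda>\<epsilon>. poly (q n) (- \<epsilon>)) \<longlongrightarrow> poly (q n) (- 0)) (at_right 0)"
      by (intro tendsto_intros)
    moreover have "poly (q n) (- 0) > 0"
      using real_line_from_direction_coeff_pos[OF p x, of n] that q[of 0 n] by (simp add: k_def)
    ultimately show ?thesis by (rule order_tendstoD)
  qed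
  then have "eventually (\<lambda>\<epsilon>. \<forall>n\<in>{..k}. poly (q n) (- \<epsilon>) > 0) (at_right 0)"
    by (intro eventually_ball_finite) auto
  then have "eventually (\<lambda>\<epsilon>. \<epsilon> > 0 \<and> (\<forall>n\<in>{..k}. poly (q n) (- \<epsilon>) > 0)) (at_right 0)"
    using eventually_at_right_less by (rule eventually_conj[rotated])
  then obtain \<epsilon> where \<epsilon>: "\<epsilon> > 0" "\<forall>n\<in>{..k}. poly (q n) (- \<epsilon>) > 0"
    using eventually_happens trivial_limit_at_right_real by blast
  have "x - \<epsilon> *\<^sub>R y \<in> hyp_cone p e"
  proof (rule mem_hyp_cone_of_coeffs[OF p])
    fix n
    show "coeff (real_line p e (x - \<epsilon> *\<^sub>R y)) n \<ge> 0"
      using q[of "- \<epsilon>" n] q0[of n] \<epsilon>(2) by (cases "n \<le> k") (auto simp: less_imp_le)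
  qed
  with no \<epsilon>(1) show False by blast
qed

section \<open>Ramsey's theorem and long chains\<close>

lemma initial_segment_of_card:
  fixes H :: "nat set"
  assumes "finite H" "k \<le> card H"
  obtains D where "D \<subseteq> H" "card D = k" "\<And>d e. d \<in> D \<Longrightarrow> e \<in> H - D \<Longrightarrow> d < e"
proof -
  have "\<exists>D\<subseteq>H. card D = k \<and> (\<forall>d\<in>D. \<forall>e\<in>H - D. d < e)"
    using assms(2)
  proof (induction k)
    case 0
    then show ?case by (intro exI[of _ "{}"]) simp
  next
    case (Suc k)
    then obtain D where D: "D \<subseteq> H" "card D = k" "\<forall>d\<in>D. \<forall>e\<in>H - D. d < e" by auto
    have "H - D \<noteq> {}" using D Suc.prems by (metis Diff_eq_empty_iff Suc_n_not_le_n subset_antisym)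
    then have m: "Min (H - D) \<in> H - D" using assms(1) by (intro Min_in) auto
    have "\<forall>d\<in>insert (Min (H - D)) D. \<forall>e\<in>H - insert (Min (H - D)) D. d < e"
      using D(3) assms(1) by (auto simp: le_less intro: Min.coboundedI order.not_eq_order_implies_strict)
    moreover have "card (insert (Min (H - D)) D) = Suc k"
      using D m assms(1) finite_subset by (subst card_insert_disjoint) auto
    ultimately show ?case using D(1) m by (intro exI[of _ "insert (Min (H - D)) D"]) auto
  qed
  then show thesis using that by blast
qed

text \<open>The threshold is a Ramsey number with the elements of \<open>I\<close> as colours. If no such \<open>W\<close> and \<open>v\<close>
  existed, colour each \<open>(k + 1)\<close>-subset by some \<open>i\<close> for which its maximum does not depend on the rest.
  In a set \<open>H\<close> of \<open>2k + 1\<close> elements with one colour \<open>i\<close>, adding the last \<open>k + 1\<close> elements one by one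
  increases the rank each time, beyond the bound \<open>k\<close>.\<close>

lemma ramsey_dependent_element:
  fixes dep :: "'i \<Rightarrow> 'a set \<Rightarrow> 'a \<Rightarrow> bool" and r :: "'i \<Rightarrow> 'a set \<Rightarrow> nat"
  assumes "finite I"
    and mono: "\<And>i W W' v. i \<in> I \<Longrightarrow> W \<subseteq> W' \<Longrightarrow> W' \<subseteq> X \<Longrightarrow> finite W' \<Longrightarrow> v \<in> X \<Longrightarrow> dep i W v \<Longrightarrow> dep i W' v"
    and rank: "\<And>i W v. i \<in> I \<Longrightarrow> W \<subseteq> X \<Longrightarrow> finite W \<Longrightarrow> v \<in> X \<Longrightarrow> \<not> dep i W v \<Longrightarrow> r i W < r i (insert v W)"
    and bound: "\<And>i W. i \<in> I \<Longrightarrow> r i W \<le> k"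
  obtains N where "\<And>V. V \<subseteq> X \<Longrightarrow> finite V \<Longrightarrow> card V \<ge> N \<Longrightarrow>
     \<exists>W v. W \<subseteq> V \<and> card W = k \<and> v \<in> V - W \<and> (\<forall>i\<in>I. dep i W v)"
proof -
  obtain js where js: "set js = I" using finite_list[OF \<open>finite I\<close>] by auto
  obtain N :: nat where N: "partn_lst {..<N} (replicate (length js) (2 * k + 1)) (Suc k)"
    using ramsey_full by blast
  have "\<exists>W v. W \<subseteq> V \<and> card W = k \<and> v \<in> V - W \<and> (\<forall>i\<in>I. dep i W v)"
    if V: "V \<subseteq> X" "finite V" "card V \<ge> N" for V
  proof (rule ccontr)
    assume no: "\<not> (\<exists>W v. W \<subseteq> V \<and> card W = k \<and> v \<in> V - W \<and> (\<forall>i\<in>I. dep i W v))"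
    obtain g where "bij_betw g {0..<card V} V" using ex_bij_betw_nat_finite[OF V(2)] by blast
    then have g: "inj_on g {..<N}" "g ` {..<N} \<subseteq> V"
      using V(3) by (auto simp: bij_betw_def intro: inj_on_subset)
    define bad where "bad j S \<longleftrightarrow> \<not> dep (js ! j) (g ` (S - {Max S})) (g (Max S))" for j S
    have "\<exists>j<length js. bad j S" if "S \<in> nsets {..<N} (Suc k)" for S
    proof -
      have S: "S \<subseteq> {..<N}" "finite S" "card S = Suc k" using that by (auto simp: nsets_def)
      then have M: "Max S \<in> S" by (intro Max_in) auto
      have inj: "inj_on g S" using g(1) S(1) inj_on_subset by blast
      have "g ` (S - {Max S}) \<subseteq> V" "card (g ` (S - {Max S})) = k" "g (Max S) \<in> V - g ` (S - {Max S})"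
        using g(2) S M inj by (auto simp: card_image inj_on_diff inj_on_eq_iff)
      then have "\<exists>i\<in>I. \<not> dep i (g ` (S - {Max S})) (g (Max S))" using no by blast
      then show ?thesis unfolding bad_def js[symmetric] by (metis in_set_conv_nth)
    qed
    then obtain f where f: "\<And>S. S \<in> nsets {..<N} (Suc k) \<Longrightarrow> f S < length js \<and> bad (f S) S"
      by metis
    have "f \<in> nsets {..<N} (Suc k) \<rightarrow> {..<length js}" using f by auto
    from partn_lstE[OF N this] obtain j H where j: "j < length js"
      and H: "H \<in> nsets {..<N} (2 * k + 1)" "f ` nsets H (Suc k) \<subseteq> {j}"
      by (auto simp: nth_replicate)
    define i where "i = js ! j"
    have i: "i \<in> I" using j js by (auto simp: i_def)
    have H': "H \<subseteq> {..<N}" "finite H" "card H = 2 * k + 1" using H(1) by (auto simp: nsets_def)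
    have bad: "\<not> dep i (g ` (S - {Max S})) (g (Max S))" if "S \<subseteq> H" "card S = Suc k" for S
    proof -
      have S: "S \<in> nsets H (Suc k)" using that H'(2) finite_subset by (auto simp: nsets_def)
      then have "S \<in> nsets {..<N} (Suc k)" using nsets_mono[OF H'(1)] by blast
      from f[OF this] H(2) S show ?thesis by (auto simp: bad_def i_def)
    qed
    have gH: "g ` S \<subseteq> X" if "S \<subseteq> H" for S using that g(2) H'(1) V(1) by blast
    obtain D where D: "D \<subseteq> H" "card D = k" "\<And>d e. d \<in> D \<Longrightarrow> e \<in> H - D \<Longrightarrow> d < e"
      using initial_segment_of_card[of H k] H' by auto
    have long: "card A \<le> r i (g ` A)" if "finite A" "A \<subseteq> H - D" "card A \<le> Suc k" for A
      using that
    proof (induction A rule: finite_linorder_max_induct)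
      case empty
      then show ?case by simp
    next
      case (insert b A)
      have b: "b \<notin> A" using insert.hyps(2) by auto
      have cA: "card A \<le> k" using insert.prems b insert.hyps(1) by simp
      \<comment> \<open>Smaller elements from \<open>D\<close> enlarge \<open>A\<close> to \<open>k\<close> elements, and independence of the larger set
        implies independence of \<open>A\<close>.\<close>
      then obtain D' where D': "D' \<subseteq> D" "card D' = k - card A"
        using obtain_subset_with_card_n[of "k - card A" D] D(2) by auto
      define S where "S = insert b (A \<union> D')"
      have fin: "finite D'" using finite_subset[OF D'(1) finite_subset[OF D(1) H'(2)]] .
      have bD: "b \<in> H" "b \<notin> D'" using insert.prems D' by auto
      have "A \<inter> D' = {}" using insert.prems D' by auto
      then have "card S = Suc k"
        using b bD insert.hyps(1) fin cA D'(2) by (simp add: S_def card_Un_disjoint)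
      moreover have "S \<subseteq> H" using insert.prems D' D(1) by (auto simp: S_def)
      moreover have "Max S = b" unfolding S_def
        using insert.hyps insert.prems fin D' D(3)[of _ b] by (intro Max_eqI) (auto intro: less_imp_le)
      moreover have "S - {b} = A \<union> D'" using b bD by (auto simp: S_def)
      ultimately have "\<not> dep i (g ` (A \<union> D')) (g b)" using bad[of S] by simp
      moreover have "g ` (A \<union> D') \<subseteq> X" "g b \<in> X"
        using gH[of "A \<union> D'"] gH[of "{b}"] insert.prems D' D(1) by auto
      ultimately have "\<not> dep i (g ` A) (g b)"
        using mono[OF i, of "g ` A" "g ` (A \<union> D')" "g b"] insert.hyps(1) fin by auto
      then have "r i (g ` A) < r i (insert (g b) (g ` A))"
        using \<open>g ` (A \<union> D') \<subseteq> X\<close> \<open>g b \<in> X\<close> insert.hyps(1) by (intro rank[OF i]) auto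
      then show ?case using insert b cA by simp
    qed
    have "card (H - D) = Suc k" using D H' by (simp add: card_Diff_subset finite_subset)
    then show False using long[of "H - D"] bound[OF i, of "g ` (H - D)"] H'(2) by simp
  qed
  then show thesis by (rule that)
qed

section \<open>Lifts of neighborly cones\<close>

theorem corollary2p3:
  fixes ip :: "real ^ 'n \<Rightarrow> real ^ 'n \<Rightarrow> real"
    and C :: "(real ^ 'n) set"
    and k :: nat
    and p :: "'q::finite mpoly"
    and e :: "real ^ 'q"
  assumes "is_inner_product ip"
    and "k > 0"
    and "proper_cone C"
    and "\<And>N :: nat. \<exists>V \<subseteq> ext_rays ip C. (infinite V \<or> card V \<ge> N) \<and> neighborly ip k C V"
    and "homogeneous_mpoly p"
    and "hyperbolic p e"
    and "\<And>f :: 'q mpoly. irreducible f \<Longrightarrow> f dvd p \<Longrightarrow> mpoly_degree f \<le> k"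
  shows "\<not> has_lift C (hyp_cone p e)"
proof
  assume "has_lift C (hyp_cone p e)"
  then obtain \<pi> :: "real ^ 'q \<Rightarrow> real ^ 'n" and L where lift:
    "linear \<pi>" "subspace L" "C = \<pi> ` (hyp_cone p e \<inter> L)" by (auto simp: has_lift_def)
  obtain F where F: "finite F" "\<And>f. f \<in> F \<Longrightarrow> hyperbolic f e" "\<And>f. f \<in> F \<Longrightarrow> mpoly_degree f \<le> k"
    "hyp_cone p e = (\<Inter>f\<in>F. hyp_cone f e)"
    using hyp_cone_as_intersection[OF assms(6,7)] by metis
  have "\<forall>v\<in>C. \<exists>z. z \<in> hyp_cone p e \<and> z \<in> L \<and> \<pi> z = v" unfolding lift(3) by blast
  then obtain x where x: "\<And>v. v \<in> C \<Longrightarrow> x v \<in> hyp_cone p e \<and> x v \<in> L \<and> \<pi> (x v) = v"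
    unfolding bchoice_iff by blast
  define y where "y W = (\<Sum>w\<in>W. x w)" for W
  \<comment> \<open>The lift of \<open>v\<close> is in the smallest face of the cone of \<open>f\<close> that contains \<open>y W\<close>.\<close>
  define dep where "dep f W v \<longleftrightarrow> (\<exists>\<epsilon>>0. y W - \<epsilon> *\<^sub>R x v \<in> hyp_cone f e)" for f W v
  have xf: "x v \<in> hyp_cone f e" if "v \<in> C" "f \<in> F" for f v using x[OF that(1)] F(4) that(2) by auto
  have yf: "y W \<in> hyp_cone f e" if "W \<subseteq> C" "f \<in> F" for f W
    using that(1) unfolding y_def
    by (induction W rule: infinite_finite_induct)
      (auto simp: zero_mem_hyp_cone F(2) that(2) xf intro!: hyp_cone_add)
  have y_split: "y W' = y W + y (W' - W)" if "W \<subseteq> W'" "finite W'" for W W'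
    unfolding y_def using sum.subset_diff[OF that] by (simp add: add.commute)
  have dep_mono: "dep f W' v" if "f \<in> F" "W \<subseteq> W'" "W' \<subseteq> C" "finite W'" "v \<in> C" "dep f W v" for f W W' v
  proof -
    note prems = that
    obtain \<epsilon> where "\<epsilon> > 0" "y W - \<epsilon> *\<^sub>R x v \<in> hyp_cone f e" using prems(6) by (auto simp: dep_def)
    moreover have "y (W' - W) \<in> hyp_cone f e" using yf that(1,3) by blast
    ultimately have "(y W - \<epsilon> *\<^sub>R x v) + y (W' - W) \<in> hyp_cone f e"
      using hyp_cone_add[OF F(2)] that(1) by blast
    then have "y W' - \<epsilon> *\<^sub>R x v \<in> hyp_cone f e" by (simp add: y_split[OF that(2,4)] algebra_simps)
    then show ?thesis using \<open>\<epsilon> > 0\<close> by (auto simp: dep_def)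
  qed
  have rank: "hyp_rank f e (y W) < hyp_rank f e (y (insert v W))"
    if "f \<in> F" "W \<subseteq> C" "finite W" "v \<in> C" "\<not> dep f W v" for f W v
  proof -
    have "v \<notin> W"
    proof
      assume "v \<in> W"
      then have "y W - 1 *\<^sub>R x v \<in> hyp_cone f e"
        using y_split[of "{v}" W] yf[of "W - {v}" f] that by (auto simp: y_def)
      then show False using that(5) unfolding dep_def by (metis zero_less_one)
    qed
    then have "y (insert v W) = y W + x v" using that(3) by (simp add: y_def add.commute)
    moreover have "hyp_rank f e (y W) < hyp_rank f e (y W + x v)"
      using hyp_rank_strict_mono[OF F(2) yf xf] that unfolding dep_def by blast
    ultimately show ?thesis by simp
  qed
  have bound: "hyp_rank f e (y W) \<le> k" if "f \<in> F" for f W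
    using hyp_rank_le[OF F(2)] F(3) that order_trans by blast
  obtain N where N: "\<And>V. V \<subseteq> C \<Longrightarrow> finite V \<Longrightarrow> card V \<ge> N \<Longrightarrow>
     \<exists>W v. W \<subseteq> V \<and> card W = k \<and> v \<in> V - W \<and> (\<forall>f\<in>F. dep f W v)"
    by (rule ramsey_dependent_element[of F C dep "\<lambda>f W. hyp_rank f e (y W)" k,
          OF F(1) dep_mono rank bound]) blast+
  obtain V where V: "V \<subseteq> ext_rays ip C" "infinite V \<or> card V \<ge> N" "neighborly ip k C V"
    using assms(4) by blast
  obtain V' where V': "V' \<subseteq> V" "finite V'" "card V' \<ge> N"
    using V(2) infinite_arbitrarily_large[of V N] by (cases "infinite V") auto
  have "v \<in> C" if "v \<in> ext_rays ip C" for v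
  proof -
    have "{c *\<^sub>R v |c. c \<ge> 0} \<subseteq> C" using that face_of_imp_subset by (auto simp: ext_rays_def)
    moreover have "v \<in> {c *\<^sub>R v |c. c \<ge> 0}" by (auto intro: exI[of _ 1])
    ultimately show ?thesis by blast
  qed
  then have "V' \<subseteq> C" using V' V(1) by blast
  from N[OF this V'(2,3)] obtain W v where
    Wv: "W \<subseteq> V'" "card W = k" "v \<in> V' - W" and dep: "\<And>f. f \<in> F \<Longrightarrow> dep f W v" by blast
  have fin: "finite W" using finite_subset[OF Wv(1) V'(2)] .
  have C: "W \<subseteq> C" "v \<in> C" using Wv \<open>V' \<subseteq> C\<close> by auto
  obtain h where h: "h \<in> dual_cone ip C" "\<And>w. w \<in> W \<Longrightarrow> ip h w = 0" "ip h v > 0"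
    using V(3)[unfolded neighborly_def, rule_format, of W] Wv V' fin by blast
  obtain \<epsilon> where \<epsilon>: "\<And>f. f \<in> F \<Longrightarrow> \<epsilon> f > 0 \<and> y W - \<epsilon> f *\<^sub>R x v \<in> hyp_cone f e"
    using dep unfolding dep_def by metis
  define \<delta> where "\<delta> = Min (insert 1 (\<epsilon> ` F))"
  have \<delta>: "\<delta> > 0" "\<And>f. f \<in> F \<Longrightarrow> \<delta> \<le> \<epsilon> f"
    using F(1) \<epsilon> by (auto simp: \<delta>_def)
  \<comment> \<open>One step size works for all factors, so this point is in the cone of \<open>p\<close> and projects to
    \<open>C\<close>, where \<open>h\<close> is nonnegative.\<close>
  let ?z = "y W - \<delta> *\<^sub>R x v"
  have "?z \<in> hyp_cone f e" if "f \<in> F" for f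
  proof -
    have "(y W - \<epsilon> f *\<^sub>R x v) + (\<epsilon> f - \<delta>) *\<^sub>R x v \<in> hyp_cone f e"
      using \<epsilon>[OF that] \<delta>(2)[OF that] xf[OF C(2) that] F(2)[OF that]
      by (intro hyp_cone_add hyp_cone_scale) auto
    then show ?thesis by (simp add: algebra_simps)
  qed
  moreover have "?z \<in> L" unfolding y_def
    using lift(2) x C by (intro subspace_diff subspace_sum subspace_scale) auto
  ultimately have "\<pi> ?z \<in> C" using lift(3) F(4) by auto
  then have "ip h (\<pi> ?z) \<ge> 0" using h(1) by (simp add: dual_cone_def)
  moreover have "\<pi> ?z = (\<Sum>w\<in>W. w) - \<delta> *\<^sub>R v"
  proof -
    have "\<pi> ?z = (\<Sum>w\<in>W. \<pi> (x w)) - \<delta> *\<^sub>R \<pi> (x v)"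
      using lift(1) by (simp add: y_def linear_diff linear_sum linear_scale)
    also have "(\<Sum>w\<in>W. \<pi> (x w)) = (\<Sum>w\<in>W. w)" using x C by (intro sum.cong) auto
    finally show ?thesis using x C by simp
  qed
  moreover have "linear (ip h)" using assms(1) by (simp add: is_inner_product_def bilinear_def)
  then have "ip h ((\<Sum>w\<in>W. w) - \<delta> *\<^sub>R v) = - \<delta> * ip h v"
    using h(2) by (simp add: linear_diff linear_sum linear_scale)
  ultimately show False using h(3) \<delta>(1) by (simp add: mult_le_0_iff)
qed

end
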